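(* Let $p$ be a prime number, let $K$ be a field with $\operatorname{char}(K)=p$, and let $F$ be either the function field $K(\alpha,\beta)$ in two algebraically independent variables $\alpha,\beta$ over $K$, or the field of iterated Laurent series $K((\alpha^{-1}))((\beta^{-1}))$. Then the maximal dimension over $F$ of a $p$-central subspace of the symbol algebra $[\alpha,\beta)_{p,F}$ is $p+1$.
   Context: For a field $F$ of characteristic $p$ (with $p$ prime), $\alpha\in F$ and $\beta\in F^\times$, the symbol $p$-algebra $[\alpha,\beta)_{p,F}$ is the associative unital $F$-algebra generated by $x,y$ with relations $x^p-x=\alpha$, $y^p=\beta$, $yxy^{-1}=x+1$; it is a central simple $F$-algebra of degree $p$ with $F$-basis $\{x^iy^j: 0\le i,j\le p-1\}$. An element $z$ of the algebra $A=[\alpha,\beta)_{p,F}$ is called $p$-central if $z^p\in F$ (where $F$ is identified with $F\cdot 1\subseteq A$). A $p$-central subspace of $A$ is an $F$-vector subspace of $A$ all of whose elements are $p$-central. The field $K((\alpha^{-1}))((\beta^{-1}))$ is the field of Laurent series in the variable $\beta^{-1}$ over the field $K((\alpha^{-1}))$ of Laurent series in the variable $\alpha^{-1}$ over $K$. *)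

theory Defs
  imports
    "HOL-Algebra.Embedded_Algebras"
    "HOL-Algebra.QuotRing"
    "HOL-Library.Poly_Mapping"
    "HOL-Computational_Algebra.Computational_Algebra"
begin

section \<open>The free associative algebra on two generators\<close>

datatype gen = Gen_x | Gen_y

text \<open>
  Words in the generators form the free monoid. The type class of monoids required for
  convolution of finitely supported functions is the (not necessarily commutative) class
  \<open>monoid_add\<close>, so concatenation is written \<open>+\<close> and the empty word is \<open>0\<close>.
\<close>

datatype gen_word = Word (letters: "gen list")

instantiation gen_word :: monoid_add
begin

definition zero_gen_word :: gen_word
  where "0 = Word []"

definition plus_gen_word :: "gen_word \<Rightarrow> gen_word \<Rightarrow> gen_word"
  where "u + v = Word (letters u @ letters v)"

instance
  by standard (simp_all add: zero_gen_word_def plus_gen_word_def)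

end

text \<open>
  The type \<open>gen_word \<Rightarrow>\<^sub>0 'f\<close> with convolution is the monoid algebra of the free monoid
  over \<open>'f\<close>, that is, the free unital associative \<open>'f\<close>-algebra on \<open>x\<close> and \<open>y\<close>.
\<close>

type_synonym 'f free_alg = "gen_word \<Rightarrow>\<^sub>0 'f"

definition free_algebra :: "'f::field free_alg ring"
  where "free_algebra = \<lparr>carrier = UNIV, monoid.mult = (*), one = 1, zero = 0, add = (+)\<rparr>"

definition free_scalar :: "'f::field \<Rightarrow> 'f free_alg"
  where "free_scalar c = Poly_Mapping.single 0 c"

definition free_x :: "'f::field free_alg"
  where "free_x = Poly_Mapping.single (Word [Gen_x]) 1"

definition free_y :: "'f::field free_alg"
  where "free_y = Poly_Mapping.single (Word [Gen_y]) 1"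

lemma free_algebra_simps [simp]:
  "carrier free_algebra = UNIV"
  "u \<otimes>\<^bsub>free_algebra\<^esub> v = u * v"
  "u \<oplus>\<^bsub>free_algebra\<^esub> v = u + v"
  "\<one>\<^bsub>free_algebra\<^esub> = 1"
  "\<zero>\<^bsub>free_algebra\<^esub> = 0"
  by (simp_all add: free_algebra_def)

lemma ring_free_algebra: "ring (free_algebra :: 'f::field free_alg ring)"
proof (rule ringI)
  show "abelian_group (free_algebra :: 'f free_alg ring)"
  proof (rule abelian_groupI)
    fix u :: "'f free_alg"
    show "\<exists>v\<in>carrier free_algebra. v \<oplus>\<^bsub>free_algebra\<^esub> u = \<zero>\<^bsub>free_algebra\<^esub>"
      by (rule bexI[of _ "- u"]) auto
  qed (auto simp: add.assoc add.commute)
  show "monoid (free_algebra :: 'f free_alg ring)"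
    by (rule monoidI) (auto simp: mult.assoc)
qed (auto simp: distrib_right distrib_left)

section \<open>Symbol algebras\<close>

text \<open>
  The relation \<open>y x y\<^sup>-\<^sup>1 = x + 1\<close> is imposed in the inverse-free form \<open>y x = (x + 1) y\<close>: for
  \<open>b \<noteq> 0\<close> the relation \<open>y\<^sup>p = b\<close> already makes \<open>y\<close> a unit, and \<open>symbol_conj\<close> below
  recovers the original form.
\<close>

definition symbol_rels :: "nat \<Rightarrow> 'f::field \<Rightarrow> 'f \<Rightarrow> 'f free_alg set"
  where "symbol_rels p a b =
    {free_x ^ p - free_x - free_scalar a,
     free_y ^ p - free_scalar b,
     free_y * free_x - (free_x + 1) * free_y}"

definition symbol_ideal :: "nat \<Rightarrow> 'f::field \<Rightarrow> 'f \<Rightarrow> 'f free_alg set"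
  where "symbol_ideal p a b = Idl\<^bsub>free_algebra\<^esub> (symbol_rels p a b)"

definition symbol_algebra :: "nat \<Rightarrow> 'f::field \<Rightarrow> 'f \<Rightarrow> 'f free_alg set ring"
  where "symbol_algebra p a b = free_algebra Quot symbol_ideal p a b"

definition symbol_class :: "nat \<Rightarrow> 'f::field \<Rightarrow> 'f \<Rightarrow> 'f free_alg \<Rightarrow> 'f free_alg set"
  where "symbol_class p a b u = symbol_ideal p a b +>\<^bsub>free_algebra\<^esub> u"

text \<open>The copy \<open>F \<cdot> 1\<close> of the base field inside the algebra.\<close>

definition symbol_scalars :: "nat \<Rightarrow> 'f::field \<Rightarrow> 'f \<Rightarrow> 'f free_alg set set"
  where "symbol_scalars p a b = range (\<lambda>c. symbol_class p a b (free_scalar c))"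

lemma ideal_symbol_ideal: "ideal (symbol_ideal p a b) free_algebra"
  unfolding symbol_ideal_def by (rule ring.genideal_ideal[OF ring_free_algebra]) simp

lemma ring_symbol_algebra: "ring (symbol_algebra p a b)"
  unfolding symbol_algebra_def by (rule ideal.quotient_is_ring[OF ideal_symbol_ideal])

lemma symbol_class_ring_hom:
  "symbol_class p a b \<in> ring_hom free_algebra (symbol_algebra p a b)"
  unfolding symbol_class_def symbol_algebra_def
  by (rule ideal.rcos_ring_hom[OF ideal_symbol_ideal])

lemma symbol_class_eqI:
  assumes "u - v \<in> symbol_ideal p a b"
  shows "symbol_class p a b u = symbol_class p a b v"
proof -
  interpret R: ring "free_algebra :: 'a free_alg ring" by (rule ring_free_algebra)
  have "\<ominus>\<^bsub>free_algebra\<^esub> v = - v"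
    by (rule R.minus_equality) simp_all
  then have "u \<ominus>\<^bsub>free_algebra\<^esub> v = u - v"
    by (simp add: R.minus_eq)
  then show ?thesis
    unfolding symbol_class_def
    using R.quotient_eq_iff_same_a_r_cos[OF ideal_symbol_ideal, of u v] assms by simp
qed

lemma symbol_rels_subset_ideal: "symbol_rels p a b \<subseteq> symbol_ideal p a b"
  unfolding symbol_ideal_def by (rule ring.genideal_self[OF ring_free_algebra]) simp

lemma symbol_class_relations:
  "symbol_class p a b (free_x ^ p - free_x) = symbol_class p a b (free_scalar a)"
  "symbol_class p a b (free_y ^ p) = symbol_class p a b (free_scalar b)"
  "symbol_class p a b (free_y * free_x) = symbol_class p a b ((free_x + 1) * free_y)"
  by (rule symbol_class_eqI, rule subsetD[OF symbol_rels_subset_ideal],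
      simp only: symbol_rels_def insert_iff simp_thms)+

lemma symbol_conj:
  fixes a b :: "'f::field"
  assumes "b \<noteq> 0" "p > 0"
  defines "A \<equiv> symbol_algebra p a b"
    and "x \<equiv> symbol_class p a b free_x" and "y \<equiv> symbol_class p a b free_y"
  shows "y \<in> Units A"
    and "y \<otimes>\<^bsub>A\<^esub> x \<otimes>\<^bsub>A\<^esub> inv\<^bsub>A\<^esub> y = x \<oplus>\<^bsub>A\<^esub> \<one>\<^bsub>A\<^esub>"
proof -
  interpret A: ring A unfolding A_def by (rule ring_symbol_algebra)
  let ?cl = "symbol_class p a b"
  have hom: "?cl \<in> ring_hom free_algebra A"
    unfolding A_def by (rule symbol_class_ring_hom)
  have cl: "?cl u \<in> carrier A" "?cl (u * v) = ?cl u \<otimes>\<^bsub>A\<^esub> ?cl v"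
    "?cl (u + v) = ?cl u \<oplus>\<^bsub>A\<^esub> ?cl v" "?cl 1 = \<one>\<^bsub>A\<^esub>" for u v
    using ring_hom_closed[OF hom, of u] ring_hom_mult[OF hom, of u v]
      ring_hom_add[OF hom, of u v] ring_hom_one[OF hom] by simp_all
  define z where "z = ?cl (free_scalar (inverse b) * free_y ^ (p - 1))"
  have pw: "free_y * free_y ^ (p - 1) = (free_y :: 'f free_alg) ^ p"
    "free_y ^ (p - 1) * free_y = (free_y :: 'f free_alg) ^ p"
    using \<open>p > 0\<close> by (cases p; simp add: power_commutes)+
  have "free_y * free_scalar (inverse b) = free_scalar (inverse b) * (free_y :: 'f free_alg)"
    by (simp add: free_y_def free_scalar_def mult_single)
  then have yz: "free_y * (free_scalar (inverse b) * free_y ^ (p - 1)) =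
      free_scalar (inverse b) * (free_y :: 'f free_alg) ^ p"
    by (simp only: mult.assoc[symmetric]) (simp only: mult.assoc pw(1))
  have sc: "free_scalar (inverse b) * free_scalar b = (1 :: 'f free_alg)"
    using \<open>b \<noteq> 0\<close> by (simp add: free_scalar_def mult_single)
  have one: "?cl (free_scalar (inverse b) * free_y ^ p) = \<one>\<^bsub>A\<^esub>"
    by (simp only: cl(2) symbol_class_relations(2)) (simp only: cl(2)[symmetric] sc cl(4))
  have z: "z \<in> carrier A" "y \<otimes>\<^bsub>A\<^esub> z = \<one>\<^bsub>A\<^esub>" "z \<otimes>\<^bsub>A\<^esub> y = \<one>\<^bsub>A\<^esub>"
    unfolding z_def y_def
    by (simp_all only: cl(1) cl(2)[symmetric] yz one mult.assoc pw(2))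
  show y: "y \<in> Units A"
    using z cl(1) unfolding Units_def y_def by blast
  have "y \<otimes>\<^bsub>A\<^esub> x = (x \<oplus>\<^bsub>A\<^esub> \<one>\<^bsub>A\<^esub>) \<otimes>\<^bsub>A\<^esub> y"
    using symbol_class_relations(3)[of p a b] by (simp add: cl x_def y_def)
  then show "y \<otimes>\<^bsub>A\<^esub> x \<otimes>\<^bsub>A\<^esub> inv\<^bsub>A\<^esub> y = x \<oplus>\<^bsub>A\<^esub> \<one>\<^bsub>A\<^esub>"
    using y by (simp add: A.m_assoc cl(1) x_def y_def)
qed

section \<open>p-central subspaces\<close>

definition p_central :: "nat \<Rightarrow> 'f::field \<Rightarrow> 'f \<Rightarrow> 'f free_alg set \<Rightarrow> bool"
  where "p_central p a b z \<longleftrightarrow>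
    z \<in> carrier (symbol_algebra p a b) \<and>
    z [^]\<^bsub>symbol_algebra p a b\<^esub> p \<in> symbol_scalars p a b"

definition symbol_subspace :: "nat \<Rightarrow> 'f::field \<Rightarrow> 'f \<Rightarrow> 'f free_alg set set \<Rightarrow> bool"
  where "symbol_subspace p a b V \<longleftrightarrow>
    additive_subgroup V (symbol_algebra p a b) \<and>
    (\<forall>c\<in>symbol_scalars p a b. \<forall>v\<in>V. c \<otimes>\<^bsub>symbol_algebra p a b\<^esub> v \<in> V)"

definition p_central_subspace :: "nat \<Rightarrow> 'f::field \<Rightarrow> 'f \<Rightarrow> 'f free_alg set set \<Rightarrow> bool"
  where "p_central_subspace p a b V \<longleftrightarrow>
    symbol_subspace p a b V \<and> (\<forall>z\<in>V. p_central p a b z)"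

definition symbol_dim ::
    "nat \<Rightarrow> 'f::field \<Rightarrow> 'f \<Rightarrow> nat \<Rightarrow> 'f free_alg set set \<Rightarrow> bool"
  where "symbol_dim p a b n V \<longleftrightarrow>
    ring.dimension (symbol_algebra p a b) n (symbol_scalars p a b) V"

text \<open>
  The upper bound includes that every \<open>p\<close>-central subspace is finite-dimensional.
\<close>

definition max_p_central_dim :: "nat \<Rightarrow> 'f::field \<Rightarrow> 'f \<Rightarrow> nat \<Rightarrow> bool"
  where "max_p_central_dim p a b m \<longleftrightarrow>
    (\<exists>V. p_central_subspace p a b V \<and> symbol_dim p a b m V) \<and>
    (\<forall>V. p_central_subspace p a b V \<longrightarrow> (\<exists>n\<le>m. symbol_dim p a b n V))"

section \<open>The two base fields\<close>

text \<open>
  The function field \<open>K(\<alpha>, \<beta>)\<close> is the fraction field of \<open>K[\<alpha>][\<beta>]\<close>: \<open>\<alpha>\<close> is the variable of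
  the inner polynomial ring, \<open>\<beta>\<close> that of the outer one.
\<close>

definition ratfun_alpha :: "'k::field poly poly fract"
  where "ratfun_alpha = Fract [:[:0, 1:]:] 1"

definition ratfun_beta :: "'k::field poly poly fract"
  where "ratfun_beta = Fract [:0, 1:] 1"

text \<open>
  In \<open>K((\<alpha>\<^sup>-\<^sup>1))((\<beta>\<^sup>-\<^sup>1))\<close> the series variables are the inverses of \<open>\<alpha>\<close> and \<open>\<beta>\<close>.
\<close>

definition laurent_alpha :: "'k::field fls fls"
  where "laurent_alpha = inverse (fls_const fls_X)"

definition laurent_beta :: "'k::field fls fls"
  where "laurent_beta = inverse fls_X"

end

theory Submission
  imports "HOL-Algebra.Algebraic_Closure_Type" "HOL-Number_Theory.Cong" Defs
begin

text \<open>
  All computations take place in the free algebra, with elements compared modulo the ideal \<open>I\<close> of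
  the relations; \<open>x\<close>, \<open>y\<close> are the generators and \<open>A\<close> is the quotient.

  \<^bold>\<open>Upper bound.\<close> Three ingredients are combined.

  \<^item> \<^emph>\<open>A trace.\<close> Over an algebraic closure choose \<open>\<theta>\<close>, \<open>\<eta>\<close> with \<open>\<theta>\<^sup>p - \<theta> = a\<close> and \<open>\<eta>\<^sup>p = b\<close>. Letting
    \<open>x\<close> act by the diagonal matrix \<open>(\<theta> + n)\<close>, \<open>n\<close> modulo \<open>p\<close>, and \<open>y\<close> by \<open>\<eta>\<close> times the cyclic shift, \<open>A\<close>
    acts by \<open>p \<times> p\<close> matrices, and the matrix trace \<open>tr\<close> satisfies \<open>tr (u v) = tr (v u)\<close>. Among
    the monomials \<open>x\<^sup>i y\<^sup>j\<close> with \<open>i, j < p\<close> it is nonzero exactly on \<open>x\<^sup>p\<^sup>-\<^sup>1\<close>. In characteristic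
    \<open>p\<close> any trace form has additive \<open>p\<close>-th powers (\<open>tr_power_char_add\<close>), which gives
    \<open>tr (u\<^sup>p) = tr (u)\<^sup>p\<close> (\<open>algtr_power\<close>). Hence if \<open>u\<^sup>p\<close> is a scalar \<open>c\<close>, then
    \<open>tr (u\<^sup>p\<^sup>-\<^sup>1)\<^sup>p = tr (c\<^sup>p\<^sup>-\<^sup>1) = 0\<close>, so that \<open>tr (u\<^sup>p\<^sup>-\<^sup>1) = 0\<close> (\<open>algtr_power_pred\<close>). Applied to \<open>u + t v\<close>
    for infinitely many scalars \<open>t\<close>, this kills the trace of every mixed term of degree \<open>p - 1\<close> in
    two elements of a \<open>p\<close>-central subspace (\<open>algtr_mixed_sum\<close>).

  \<^item> \<^emph>\<open>A degree.\<close> Both base fields carry a degree with values in \<open>\<int> \<times> \<int>\<close>, ordered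
    lexicographically, for which \<open>a\<close> and \<open>b\<close> have the degrees \<open>(1, 0)\<close> and \<open>(0, 1)\<close>. Giving \<open>x\<close> and
    \<open>y\<close> one \<open>p\<close>-th of these degrees extends it to \<open>A\<close>. The terms of \<open>\<Sum> c\<^sub>i\<^sub>j x\<^sup>i y\<^sup>j\<close> then have
    different degrees, so every nonzero element has a leading monomial with exponents \<open>(i, j)\<close>
    (\<open>Lead_exists\<close>). As \<open>y x - x y = y\<close> has smaller degree than \<open>x y\<close>, leading monomials multiply as
    commuting variables, and the mixed term of bidegree \<open>(r, m)\<close> in \<open>u\<close>, \<open>v\<close> has as leading coefficient
    a binomial coefficient times a product of powers (\<open>Lead_mixed_sum\<close>). For \<open>r + m = p - 1\<close>
    this is nonzero. So if moreover \<open>r (i, j) + m (k, l)\<close> is congruent to \<open>(p - 1, 0)\<close> modulo \<open>p\<close>,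
    where \<open>(i, j)\<close>, \<open>(k, l)\<close> are the leading exponents of \<open>u\<close>, \<open>v\<close>, the mixed term has nonzero
    trace (\<open>algtr_Lead_nonzero\<close>).

  \<^item> \<^emph>\<open>A pigeonhole argument.\<close> Among any \<open>p + 2\<close> points of the plane over the field with \<open>p\<close>
    elements, two admit such a combination (\<open>weighted_pair_exists\<close>): after translation by
    \<open>(-1, 0)\<close> one needs \<open>r s + m s' = 0\<close> with \<open>r + m = p - 1\<close>, which is solvable as soon as \<open>s\<close> and
    \<open>s'\<close> are distinct and parallel, and there are only \<open>p + 1\<close> directions.

  Thus the elements of a \<open>p\<close>-central subspace \<open>V\<close> have at most \<open>p + 1\<close> different leading exponents
  (\<open>card_lead_positions\<close>). An element of \<open>V\<close> whose coordinates at these exponents all vanish is zero, so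
  \<open>V\<close> has dimension at most \<open>p + 1\<close>.

  \<^bold>\<open>Lower bound.\<close> The space \<open>F + F[x] y\<close> has dimension \<open>p + 1\<close>. Its elements are \<open>p\<close>-central since
  \<open>(c + g(x) y)\<^sup>p = c\<^sup>p + (g(x) y)\<^sup>p\<close>, and \<open>(g(x) y)\<^sup>p\<close> is the product of the \<open>p\<close> shifts \<open>g(x + j)\<close>, times
  \<open>b\<close>. That product is invariant under \<open>x \<mapsto> x + 1\<close>, hence a polynomial in \<open>x\<^sup>p - x = a\<close>.
\<close>

section \<open>Mixed terms of powers and trace forms\<close>

lemma of_nat_left_commute: "u * (of_nat n * w) = of_nat n * (u * w)" for u w :: "'a::semiring_1"
  by (metis mult.assoc mult_of_nat_commute)

text \<open>
  The sum of all products of \<open>n - m\<close> factors \<open>u\<close> and \<open>m\<close> factors \<open>v\<close>, in any order. It is the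
  coefficient of \<open>t\<^sup>m\<close> in \<open>(u + t v)\<^sup>n\<close> for a central indeterminate \<open>t\<close>; power series over a
  non-commutative ring provide that indeterminate.
\<close>

definition mixed_sum :: "'a::ring_1 \<Rightarrow> 'a \<Rightarrow> nat \<Rightarrow> nat \<Rightarrow> 'a"
  where "mixed_sum u v n m = ((fps_const u + fps_X * fps_const v) ^ n) $ m"

lemma mixed_sum_0: "mixed_sum u v 0 m = (if m = 0 then 1 else 0)"
  by (simp add: mixed_sum_def)

lemma mixed_sum_Suc:
  "mixed_sum u v (Suc n) m =
    u * mixed_sum u v n m + (if m = 0 then 0 else v * mixed_sum u v n (m - 1))"
  by (simp add: mixed_sum_def distrib_right mult.assoc)

lemma mixed_sum_gt: "m > n \<Longrightarrow> mixed_sum u v n m = 0"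
  by (induction n arbitrary: m) (simp_all add: mixed_sum_0 mixed_sum_Suc)

lemma mixed_sum_bot: "mixed_sum u v n 0 = u ^ n"
  by (induction n) (simp_all add: mixed_sum_0 mixed_sum_Suc)

lemma mixed_sum_top: "mixed_sum u v n n = v ^ n"
  by (induction n) (simp_all add: mixed_sum_0 mixed_sum_Suc mixed_sum_gt)

lemma mixed_sum_1: "mixed_sum u 1 n m = of_nat (n choose m) * u ^ (n - m)"
proof (induction n arbitrary: m)
  case 0
  then show ?case by (cases m) (simp_all add: mixed_sum_0)
next
  case (Suc n)
  show ?case
  proof (cases m)
    case 0
    then show ?thesis by (simp add: mixed_sum_bot)
  next
    case m: (Suc k)
    have "u * (of_nat (n choose Suc k) * u ^ (n - Suc k)) = of_nat (n choose Suc k) * u ^ (n - k)"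
    proof (cases "k < n")
      case True
      then have "n - k = Suc (n - Suc k)" by simp
      then show ?thesis by (simp add: of_nat_left_commute)
    qed (simp add: binomial_eq_0)
    then show ?thesis by (simp add: m mixed_sum_Suc Suc distrib_right add.commute)
  qed
qed

lemma power_add_central:
  fixes u v t :: "'a::ring_1"
  assumes t: "\<And>w. t * w = w * t"
  shows "(u + t * v) ^ n = (\<Sum>m\<le>n. t ^ m * mixed_sum u v n m)"
proof (induction n)
  case 0
  show ?case by (simp add: mixed_sum_0)
next
  case (Suc n)
  have tm: "t ^ m * w = w * t ^ m" for m w
    by (induction m) (simp_all add: mult.assoc, metis mult.assoc t)
  have "(u + t * v) ^ Suc n = (\<Sum>m\<le>n. u * (t ^ m * mixed_sum u v n m))
      + (\<Sum>m\<le>n. t * v * (t ^ m * mixed_sum u v n m))"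
    by (simp add: Suc distrib_right sum_distrib_left sum.distrib)
  also have "(\<Sum>m\<le>n. u * (t ^ m * mixed_sum u v n m)) =
      (\<Sum>m\<le>Suc n. t ^ m * (u * mixed_sum u v n m))"
    by (simp add: mixed_sum_gt) (intro sum.cong refl, metis mult.assoc tm)
  also have "(\<Sum>m\<le>n. t * v * (t ^ m * mixed_sum u v n m)) =
      (\<Sum>m\<le>n. t ^ Suc m * (v * mixed_sum u v n m))"
    by (intro sum.cong refl) (metis mult.assoc power_Suc tm)
  also have "\<dots> = (\<Sum>m\<le>Suc n. t ^ m * (if m = 0 then 0 else v * mixed_sum u v n (m - 1)))"
    by (subst sum.atMost_Suc_shift) simp
  finally show ?case
    by (simp only: mixed_sum_Suc distrib_left sum.distrib)
qed

text \<open>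
  A trace form is an additive map to a commutative ring that does not see the order of the two
  factors of a product.
\<close>

locale trace_form =
  fixes tr :: "'a::ring_1 \<Rightarrow> 'b::comm_ring_1"
  assumes tr_add: "tr (u + v) = tr u + tr v"
    and tr_commute: "tr (u * v) = tr (v * u)"
begin

lemma tr_0: "tr 0 = 0"
  using tr_add[of 0 0] by simp

lemma tr_minus: "tr (- u) = - tr u"
  using tr_add[of u "- u"] by (simp add: tr_0 eq_neg_iff_add_eq_0 add.commute)

lemma tr_diff: "tr (u - v) = tr u - tr v"
  using tr_add[of u "- v"] by (simp add: tr_minus)

lemma tr_sum: "tr (sum f A) = (\<Sum>x\<in>A. tr (f x))"
  by (induction A rule: infinite_finite_induct) (simp_all add: tr_0 tr_add)

lemma tr_of_nat: "tr (of_nat n * u) = of_nat n * tr u"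
  by (induction n) (simp_all add: tr_0 tr_add distrib_right)

lemma tr_fps_commute: "tr ((f * g) $ m) = tr ((g * f) $ m)"
proof -
  have "tr ((f * g) $ m) = (\<Sum>i=0..m. tr (g $ (m - i) * f $ i))"
    by (simp add: fps_mult_nth tr_sum tr_commute)
  also have "\<dots> = (\<Sum>i=0..m. tr (g $ i * f $ (m - i)))"
    by (rule sum.reindex_bij_witness[of _ "\<lambda>i. m - i" "\<lambda>i. m - i"]) auto
  finally show ?thesis
    by (simp add: fps_mult_nth tr_sum)
qed

text \<open>
  Under a trace form the factors of the derivative of \<open>f\<^sup>n\<close> may be rotated, so the rule
  \<open>(f\<^sup>n)' = n f\<^sup>n\<^sup>-\<^sup>1 f'\<close> holds without commutativity.
\<close>

lemma tr_deriv_power: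
  "tr ((f ^ k * fps_deriv (f ^ n)) $ m) = of_nat n * tr ((f ^ (k + n - 1) * fps_deriv f) $ m)"
proof (induction n arbitrary: k)
  case 0
  show ?case by (simp add: tr_0)
next
  case (Suc n)
  have "f ^ k * fps_deriv (f ^ Suc n) =
      f ^ Suc k * fps_deriv (f ^ n) + (f ^ k * fps_deriv f) * f ^ n"
    by (simp add: distrib_left mult.assoc power_commutes)
       (metis mult.assoc power_commutes)
  moreover have "tr (((f ^ k * fps_deriv f) * f ^ n) $ m) =
      tr ((f ^ (k + n) * fps_deriv f) $ m)"
    by (subst tr_fps_commute) (simp add: mult.assoc[symmetric] power_add[symmetric] add.commute)
  ultimately show ?case
    using Suc[of "Suc k"] by (simp add: tr_add distrib_right)
qed

text \<open>
  The \<open>p\<close>-th power is additive under a trace form in characteristic \<open>p\<close>: by the previous rule, \<open>m\<close> times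
  the trace of the mixed term of order \<open>m\<close> is a multiple of \<open>p\<close>, so only the two outer terms survive.
\<close>

lemma tr_power_char_add:
  assumes p: "prime p" and cp: "CHAR('b) = p" and dom: "\<And>x y::'b. x * y = 0 \<Longrightarrow> x = 0 \<or> y = 0"
  shows "tr ((u + v) ^ p) = tr (u ^ p) + tr (v ^ p)"
proof -
  have *: "tr (mixed_sum u v p m) = 0" if m: "0 < m" "m < p" for m
  proof -
    let ?f = "fps_const u + fps_X * fps_const v"
    have "tr (fps_deriv (?f ^ p) $ (m - 1)) = 0"
      using tr_deriv_power[of ?f 0 p "m - 1"] cp by (metis lambda_one mult_zero_left of_nat_CHAR power_0)
    then have "of_nat m * tr (mixed_sum u v p m) = 0"
      using m(1) by (simp add: mixed_sum_def tr_of_nat flip: of_nat_Suc)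
    moreover have "of_nat m \<noteq> (0::'b)"
      using m cp by (auto simp: of_nat_eq_0_iff_char_dvd dest: dvd_imp_le)
    ultimately show ?thesis using dom by blast
  qed
  have p0: "p > 0" using p by (rule prime_gt_0_nat)
  have "tr ((u + v) ^ p) = (\<Sum>m\<le>p. tr (mixed_sum u v p m))"
    using power_add_central[of 1 u v p] by (simp add: tr_sum)
  also have "\<dots> = (\<Sum>m\<in>{0, p}. tr (mixed_sum u v p m))"
    by (rule sum.mono_neutral_right) (use * in auto)
  finally show ?thesis
    using p0 by (simp add: mixed_sum_bot mixed_sum_top)
qed

end

section \<open>Words and scalars in the free algebra\<close>

lemma free_scalar_simps:
  fixes c d :: "'f::field"
  shows "free_scalar (0::'f) = 0" "free_scalar (1::'f) = 1" "free_scalar (c + d) = free_scalar c + free_scalar d"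
  "free_scalar (- c) = - free_scalar c" "free_scalar (c - d) = free_scalar c - free_scalar d"
  "free_scalar (c * d) = free_scalar c * free_scalar d"
  "free_scalar (c ^ n) = free_scalar c ^ n"
proof -
  have *: "free_scalar (1::'f) = 1" "free_scalar (c * d) = free_scalar c * free_scalar d" for c d :: 'f
    by (simp_all add: free_scalar_def mult_single)
  show "free_scalar (1::'f) = 1" "free_scalar (c * d) = free_scalar c * free_scalar d"
    by (rule *)+
  show "free_scalar (c ^ n) = free_scalar c ^ n"
    by (induction n) (simp_all add: *)
qed (simp_all add: free_scalar_def single_add single_uminus single_diff)

lemma free_alg_induct:
  fixes u :: "'f::field free_alg"
  assumes single: "\<And>w c. P (Poly_Mapping.single w c)" and add: "\<And>u v. P u \<Longrightarrow> P v \<Longrightarrow> P (u + v)"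
  shows "P u"
proof (induction u rule: update_induct)
  case const
  show ?case using single[of 0 0] by simp
next
  case (update f w c)
  then have "Poly_Mapping.update w c f = f + Poly_Mapping.single w c"
    by (intro poly_mapping_eqI) (auto simp: lookup_add lookup_update lookup_single in_keys_iff when_def)
  then show ?case using update single add by simp
qed

lemma free_scalar_commute: "free_scalar c * u = u * free_scalar (c :: 'f::field)"
  by (induction u rule: free_alg_induct)
     (simp_all add: free_scalar_def mult_single mult.commute distrib_left distrib_right)

lemma letters_simps [simp]: "letters 0 = []" "letters (u + v) = letters u @ letters v"
  by (simp_all add: zero_gen_word_def plus_gen_word_def)

lemma free_x_power: "free_x ^ i = Poly_Mapping.single (Word (replicate i Gen_x)) 1"
  by (induction i) (simp_all add: free_x_def mult_single plus_gen_word_def flip: zero_gen_word_def)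

lemma free_y_power: "free_y ^ i = Poly_Mapping.single (Word (replicate i Gen_y)) 1"
  by (induction i) (simp_all add: free_y_def mult_single plus_gen_word_def flip: zero_gen_word_def)

lemma single_power:
  "Poly_Mapping.single w c ^ k = Poly_Mapping.single (Word (concat (replicate k (letters w)))) (c ^ k)"
  by (induction k) (simp_all add: mult_single plus_gen_word_def flip: zero_gen_word_def)

lemma free_scalar_mult_mult:
  "free_scalar c * u * (free_scalar d * v) = free_scalar (c * d) * (u * v)"
proof -
  have "free_scalar c * u * (free_scalar d * v) = free_scalar c * (u * free_scalar d) * v"
    by (simp only: mult.assoc)
  also have "u * free_scalar d = free_scalar d * u"
    by (rule free_scalar_commute[symmetric])
  finally show ?thesis by (simp only: free_scalar_simps mult.assoc)
qed

lemma free_scalar_left_commute: "u * (free_scalar c * v) = free_scalar c * (u * v)"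
  using free_scalar_mult_mult[of 1 u c v] by (simp add: free_scalar_simps)

section \<open>The symbol ideal\<close>

text \<open>
  The symbol algebra \<open>[a, b)\<close> in characteristic \<open>p\<close>. The abbreviations \<open>gx\<close> and \<open>gy\<close> are the generators
  of the free algebra, and \<open>sI\<close> is the ideal of the relations.
\<close>

locale symbol_setting =
  fixes p :: nat and a b :: "'f::field"
  assumes p: "prime p" and char_p: "CHAR('f) = p" and b: "b \<noteq> 0"
begin

abbreviation "sI \<equiv> symbol_ideal p a b"
abbreviation "gx \<equiv> (free_x :: 'f free_alg)"
abbreviation "gy \<equiv> (free_y :: 'f free_alg)"

lemma p2: "p \<ge> 2" using p by (rule prime_ge_2_nat)

lemma ideal_add: "u \<in> sI \<Longrightarrow> v \<in> sI \<Longrightarrow> u + v \<in> sI"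
  using additive_subgroup.a_closed[OF ideal.axioms(1)[OF ideal_symbol_ideal]] by simp

lemma ideal_0: "0 \<in> sI"
  using additive_subgroup.zero_closed[OF ideal.axioms(1)[OF ideal_symbol_ideal]] by simp

lemma ideal_mult_left: "u \<in> sI \<Longrightarrow> v * u \<in> sI"
  using ideal.I_l_closed[OF ideal_symbol_ideal] by simp

lemma ideal_mult_right: "u \<in> sI \<Longrightarrow> u * v \<in> sI"
  using ideal.I_r_closed[OF ideal_symbol_ideal] by simp

lemma ideal_sum: "(\<And>x. x \<in> A \<Longrightarrow> f x \<in> sI) \<Longrightarrow> sum f A \<in> sI"
  by (induction A rule: infinite_finite_induct) (simp_all add: ideal_0 ideal_add)

lemma ideal_rels:
  "gx ^ p - gx - free_scalar a \<in> sI" "gy ^ p - free_scalar b \<in> sI" "gy * gx - (gx + 1) * gy \<in> sI"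
  using symbol_rels_subset_ideal[of p a b] by (simp_all add: symbol_rels_def)

lemma of_nat_char: "p dvd n \<Longrightarrow> of_nat n = (0 :: 'f free_alg)"
proof -
  assume "p dvd n"
  then have "free_scalar (of_nat n :: 'f) = 0"
    using char_p by (simp add: of_nat_eq_0_iff_char_dvd[THEN iffD2] free_scalar_simps)
  then show ?thesis by (simp add: free_scalar_def)
qed

lemma gy_power_gx: "gy ^ j * gx - (gx + of_nat j) * gy ^ j \<in> sI"
proof (induction j)
  case (Suc j)
  have "gy ^ Suc j * gx - (gx + of_nat (Suc j)) * gy ^ Suc j =
      gy * (gy ^ j * gx - (gx + of_nat j) * gy ^ j) + (gy * gx - (gx + 1) * gy) * gy ^ j"
    by (simp add: right_diff_distrib left_diff_distrib distrib_left distrib_right mult.assoc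
        of_nat_left_commute[of gy])
  then show ?case
    using ideal_add[OF ideal_mult_left[OF Suc, of gy] ideal_mult_right[OF ideal_rels(3), of "gy ^ j"]]
    by (simp only:)
qed (simp add: ideal_0)

lemma gy_power_gx_power: "gy ^ j * gx ^ k - (gx + of_nat j) ^ k * gy ^ j \<in> sI"
proof (induction k)
  case (Suc k)
  have "gy ^ j * gx ^ Suc k - (gx + of_nat j) ^ Suc k * gy ^ j =
      (gy ^ j * gx - (gx + of_nat j) * gy ^ j) * gx ^ k +
      (gx + of_nat j) * (gy ^ j * gx ^ k - (gx + of_nat j) ^ k * gy ^ j)"
    by (simp add: right_diff_distrib left_diff_distrib mult.assoc)
  then show ?case
    using ideal_add[OF ideal_mult_right[OF gy_power_gx] ideal_mult_left[OF Suc]] by simp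
qed (simp add: ideal_0)

end

section \<open>A trace form on the symbol algebra\<close>

text \<open>
  Words act on functions on the integers modulo \<open>p\<close>: the letter \<open>x\<close> multiplies the value at \<open>n\<close> by
  \<open>\<theta> + n\<close>, and \<open>y\<close> sends \<open>f\<close> to the function with value \<open>\<eta> f (n + 1)\<close> at \<open>n\<close>. A word \<open>w\<close> thus acts
  by a monomial matrix: it sends \<open>f\<close> to the function with value \<open>diag \<theta> \<eta> w n * f (n + ydeg w)\<close> at
  \<open>n\<close>. Residues are represented by arbitrary natural numbers, since \<open>diag\<close> has period \<open>p\<close> in
  characteristic \<open>p\<close>.
\<close>

fun ydeg :: "gen list \<Rightarrow> nat" where
  "ydeg [] = 0"
| "ydeg (Gen_x # w) = ydeg w"
| "ydeg (Gen_y # w) = Suc (ydeg w)"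

fun diag :: "'r::comm_ring_1 \<Rightarrow> 'r \<Rightarrow> gen list \<Rightarrow> nat \<Rightarrow> 'r" where
  "diag \<theta> \<eta> [] n = 1"
| "diag \<theta> \<eta> (Gen_x # w) n = (\<theta> + of_nat n) * diag \<theta> \<eta> w n"
| "diag \<theta> \<eta> (Gen_y # w) n = \<eta> * diag \<theta> \<eta> w (Suc n)"

lemma ydeg_append: "ydeg (u @ v) = ydeg u + ydeg v"
  by (induction u rule: ydeg.induct) simp_all

lemma ydeg_replicate: "ydeg (replicate i Gen_x) = 0" "ydeg (replicate i Gen_y) = i"
  by (induction i) simp_all

lemma ydeg_concat_replicate: "ydeg (concat (replicate k w)) = k * ydeg w"
  by (induction k) (simp_all add: ydeg_append)

lemma diag_append: "diag \<theta> \<eta> (u @ v) n = diag \<theta> \<eta> u n * diag \<theta> \<eta> v (n + ydeg u)"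
  by (induction u arbitrary: n rule: ydeg.induct) (simp_all add: mult.assoc)

lemma diag_replicate:
  "diag \<theta> \<eta> (replicate i Gen_x) n = (\<theta> + of_nat n) ^ i"
  "diag \<theta> \<eta> (replicate i Gen_y) n = \<eta> ^ i"
  by (induction i arbitrary: n) simp_all

lemma diag_concat_replicate:
  "diag \<theta> \<eta> (concat (replicate k w)) n = (\<Prod>l<k. diag \<theta> \<eta> w (n + l * ydeg w))"
proof (induction k arbitrary: n)
  case (Suc k)
  show ?case
    by (simp only: prod.lessThan_Suc_shift) (simp add: diag_append Suc add.assoc)
qed simp

lemma sum_periodic_shift:
  fixes f :: "nat \<Rightarrow> 'a::comm_monoid_add"
  assumes f: "\<And>n. f (n + p) = f n"
  shows "(\<Sum>n<p. f (n + k)) = (\<Sum>n<p. f n)"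
proof (induction k)
  case (Suc k)
  have "(\<Sum>n<p. f (n + Suc k)) = (\<Sum>n<p. f (n + k))"
  proof (cases p)
    case (Suc q)
    have "(\<Sum>n<p. f (n + k)) = f k + (\<Sum>n<q. f (Suc n + k))"
      unfolding Suc by (subst sum.lessThan_Suc_shift) simp
    moreover have "(\<Sum>n<p. f (n + Suc k)) = (\<Sum>n<q. f (Suc n + k)) + f (k + p)"
      unfolding Suc by (simp add: add.commute)
    ultimately show ?thesis by (simp add: f add.commute)
  qed simp
  then show ?case by (simp add: Suc)
qed simp

lemma periodic_mod:
  fixes f :: "nat \<Rightarrow> 'a"
  assumes f: "\<And>n. f (n + p) = f n"
  shows "f (n + k * p) = f n" "f (n mod p) = f n"
proof -
  show *: "f (n + k * p) = f n" for n k
    by (induction k) (simp_all, metis add.assoc add.commute f)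
  show "f (n mod p) = f n"
    using *[of "n mod p" "n div p"] by simp
qed

lemma prod_periodic_multiples:
  fixes f :: "nat \<Rightarrow> 'a::comm_monoid_mult"
  assumes f: "\<And>n. f (n + p) = f n" and j: "coprime j p" and p: "p > 0"
  shows "(\<Prod>l<p. f (n + l * j)) = (\<Prod>l<p. f l)"
proof -
  have inj: "inj_on (\<lambda>l. (n + l * j) mod p) {..<p}"
  proof (rule inj_onI)
    fix k l assume kl: "k \<in> {..<p}" "l \<in> {..<p}" "(n + k * j) mod p = (n + l * j) mod p"
    then have "[k * j = l * j] (mod p)"
      by (metis cong_add_lcancel_nat cong_def)
    then have "[k = l] (mod p)"
      using j by (simp add: cong_mult_rcancel_nat)
    then show "k = l" using kl by (simp add: cong_def)
  qed
  have "(\<lambda>l. (n + l * j) mod p) ` {..<p} = {..<p}"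
    by (rule endo_inj_surj) (use inj p in auto)
  then have "bij_betw (\<lambda>l. (n + l * j) mod p) {..<p} {..<p}"
    using inj by (simp add: bij_betw_def)
  then have "(\<Prod>l<p. f ((n + l * j) mod p)) = (\<Prod>l<p. f l)"
    by (rule prod.reindex_bij_betw)
  then show ?thesis
    using periodic_mod(2)[of f p, OF f] by simp
qed

text \<open>
  The trace of the monomial matrix of a word; its diagonal vanishes unless the shift is trivial.
\<close>

definition word_tr :: "'r::comm_ring_1 \<Rightarrow> 'r \<Rightarrow> nat \<Rightarrow> gen list \<Rightarrow> 'r"
  where "word_tr \<theta> \<eta> p w = (if p dvd ydeg w then \<Sum>n<p. diag \<theta> \<eta> w n else 0)"

text \<open>
  Summing the binomial expansion of \<open>(\<theta> + n + 1)\<^sup>i\<^sup>+\<^sup>1\<close> over a period telescopes, so \<open>i + 1\<close> times the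
  sum of the \<open>i\<close>-th powers is a combination of the lower power sums. This settles all \<open>i < p - 1\<close>.
  For \<open>i = p - 1\<close> expanding in powers of \<open>n\<close> leaves the sum of the \<open>n\<^sup>p\<^sup>-\<^sup>1\<close>, which Fermat's little
  theorem evaluates.
\<close>

lemma power_sum_char:
  fixes \<theta> :: "'r::field"
  assumes p: "prime p" and cp: "CHAR('r) = p"
  shows "i < p - 1 \<Longrightarrow> (\<Sum>n<p. (\<theta> + of_nat n) ^ i) = 0"
    and "(\<Sum>n<p. (\<theta> + of_nat n) ^ (p - 1)) = - 1"
proof -
  have p2: "p \<ge> 2" using p by (rule prime_ge_2_nat)
  have *: "(\<Sum>n<p. (t + of_nat n) ^ i) = 0" if "i < p - 1" for i and t :: 'r
    using that
  proof (induction i rule: less_induct)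
    case (less i)
    let ?f = "\<lambda>n. (t + of_nat n) ^ Suc i"
    have per: "?f (n + p) = ?f n" for n
      using cp by auto
    have "?f (Suc n) = (\<Sum>k\<le>Suc i. of_nat (Suc i choose k) * (t + of_nat n) ^ k)" for n
      using binomial_ring[of "t + of_nat n" 1 "Suc i"] by (simp add: add_ac)
    then have "(\<Sum>n<p. ?f (n + 1)) =
        (\<Sum>k\<le>Suc i. of_nat (Suc i choose k) * (\<Sum>n<p. (t + of_nat n) ^ k))"
      by (simp add: sum_distrib_left sum.swap[of _ "{..<p}"])
    also have "\<dots> = (\<Sum>k\<in>{i, Suc i}. of_nat (Suc i choose k) * (\<Sum>n<p. (t + of_nat n) ^ k))"
      by (rule sum.mono_neutral_right) (use less in auto)
    also have "\<dots> = of_nat (Suc i) * (\<Sum>n<p. (t + of_nat n) ^ i) + (\<Sum>n<p. ?f n)"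
      by simp
    finally have "of_nat (Suc i) * (\<Sum>n<p. (t + of_nat n) ^ i) = 0"
      using sum_periodic_shift[of ?f p 1, OF per] by simp
    moreover have "of_nat (Suc i) \<noteq> (0::'r)"
      using less.prems cp by (auto simp only: of_nat_eq_0_iff_char_dvd dest!: dvd_imp_le)
    ultimately show ?case by (metis mult_eq_0_iff)
  qed
  show "i < p - 1 \<Longrightarrow> (\<Sum>n<p. (\<theta> + of_nat n) ^ i) = 0"
    by (rule *)
  have fermat: "of_nat n ^ (p - 1) = (if n = 0 then 0 else 1 :: 'r)" if "n < p" for n
  proof (cases "n = 0")
    case False
    have n: "\<not> p dvd n" using False that by (auto dest: dvd_imp_le)
    have "(of_nat n :: 'r) ^ p = of_nat n"
    proof (induction n)
      case (Suc n)
      have "(of_nat n + 1 :: 'r) ^ p = of_nat n ^ p + 1 ^ p"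
        by (rule freshmans_dream) (simp_all add: p cp)
      then show ?case using Suc by (simp add: add.commute)
    qed (use p2 in simp)
    then have "of_nat n * (of_nat n ^ (p - 1) :: 'r) = of_nat n * 1"
      using p2 by (metis One_nat_def Suc_pred mult.right_neutral not_gr_zero not_numeral_le_zero power_Suc)
    moreover have "of_nat n \<noteq> (0::'r)"
      using n cp by (simp add: of_nat_eq_0_iff_char_dvd)
    ultimately show ?thesis using False by (metis mult_cancel_left)
  qed (use p2 in simp)
  have "(\<Sum>n<p. (\<theta> + of_nat n) ^ (p - 1)) =
      (\<Sum>n<p. \<Sum>k\<le>p - 1. of_nat ((p - 1) choose k) * of_nat n ^ k * \<theta> ^ (p - 1 - k))"
    by (subst add.commute) (simp only: binomial_ring)
  also have "\<dots> = (\<Sum>k\<le>p - 1. of_nat ((p - 1) choose k) * (\<Sum>n<p. (0 + of_nat n) ^ k) * \<theta> ^ (p - 1 - k))"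
    by (subst sum.swap) (simp add: sum_distrib_left sum_distrib_right)
  also have "\<dots> = (\<Sum>k\<in>{p - 1}. of_nat ((p - 1) choose k) * (\<Sum>n<p. (0 + of_nat n) ^ k) * \<theta> ^ (p - 1 - k))"
  proof (rule sum.mono_neutral_right)
    have "(\<Sum>n<p. (0 + of_nat n :: 'r) ^ i) = 0" if "i \<in> {..p - 1} - {p - 1}" for i
      using that by (intro *) auto
    then show "\<forall>i\<in>{..p - 1} - {p - 1}. of_nat ((p - 1) choose i) *
        (\<Sum>n<p. (0 + of_nat n) ^ i) * \<theta> ^ (p - 1 - i) = 0"
      by (metis mult_zero_left mult_zero_right)
  qed auto
  also have "\<dots> = (\<Sum>n<p. if n = 0 then 0 else 1 :: 'r)"
    using fermat by simp
  also have "\<dots> = (\<Sum>n<p. 1) - (\<Sum>n<p. if n = 0 then 1 else 0 :: 'r)"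
    by (subst sum_subtractf[symmetric], rule sum.cong) auto
  also have "\<dots> = - 1"
    using p2 cp by (auto simp: sum.delta)
  finally show "(\<Sum>n<p. (\<theta> + of_nat n) ^ (p - 1)) = - 1" .
qed

context
  fixes p :: nat and \<theta> \<eta> :: "'r::field"
  assumes p: "prime p" and cp: "CHAR('r) = p"
begin

lemma diag_periodic: "diag \<theta> \<eta> w (n + p) = diag \<theta> \<eta> w n"
  by (induction w arbitrary: n rule: ydeg.induct) (use cp in \<open>auto simp: add.assoc simp flip: add_Suc\<close>)

lemma word_tr_commute: "word_tr \<theta> \<eta> p (u @ v) = word_tr \<theta> \<eta> p (v @ u)"
proof (cases "p dvd ydeg u + ydeg v")
  case True
  let ?f = "\<lambda>n. diag \<theta> \<eta> u (n + ydeg v) * diag \<theta> \<eta> v n"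
  have per: "?f (n + p) = ?f n" for n
    using diag_periodic[of u "n + ydeg v"] diag_periodic[of v n] by (simp add: add_ac)
  obtain k where k: "ydeg v + ydeg u = k * p" using True by (metis add.commute dvdE mult.commute)
  have "diag \<theta> \<eta> u (n + (ydeg u + ydeg v)) = diag \<theta> \<eta> u n" for n
    using periodic_mod(1)[of "diag \<theta> \<eta> u" p n k, OF diag_periodic] k by (simp add: add.commute)
  then have "(\<Sum>n<p. diag \<theta> \<eta> u n * diag \<theta> \<eta> v (n + ydeg u)) = (\<Sum>n<p. ?f (n + ydeg u))"
    by (simp add: add.assoc)
  also have "\<dots> = (\<Sum>n<p. ?f n)"
    by (rule sum_periodic_shift) (rule per)
  finally show ?thesis
    by (simp add: word_tr_def ydeg_append diag_append mult.commute add.commute)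
qed (simp add: word_tr_def ydeg_append add.commute)

text \<open>
  If \<open>p\<close> does not divide the shift of \<open>w\<close>, all diagonal entries of the \<open>p\<close>-th power of its matrix are the
  same product over a full period, so their sum is \<open>p\<close> times that product and vanishes.
\<close>

lemma word_tr_power: "word_tr \<theta> \<eta> p (concat (replicate p w)) = word_tr \<theta> \<eta> p w ^ p"
proof (cases "p dvd ydeg w")
  case True
  then obtain j where j: "ydeg w = j * p" by (metis dvdE mult.commute)
  have "diag \<theta> \<eta> w (n + l * ydeg w) = diag \<theta> \<eta> w n" for n l
    using periodic_mod(1)[of "diag \<theta> \<eta> w" p n "l * j", OF diag_periodic] j
    by (simp add: mult.assoc)
  moreover have "(\<Sum>n<p. diag \<theta> \<eta> w n) ^ p = (\<Sum>n<p. diag \<theta> \<eta> w n ^ p)"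
    by (rule freshmans_dream_sum) (use p cp in auto)
  ultimately show ?thesis
    using True by (simp add: word_tr_def ydeg_concat_replicate diag_concat_replicate)
next
  case False
  then have "coprime (ydeg w) p"
    using p by (simp add: coprime_commute prime_imp_coprime)
  then have "(\<Prod>l<p. diag \<theta> \<eta> w (n + l * ydeg w)) = (\<Prod>l<p. diag \<theta> \<eta> w l)" for n
    by (intro prod_periodic_multiples diag_periodic) (use p prime_gt_0_nat in auto)
  then show ?thesis
    using False cp prime_gt_0_nat[OF p]
    by (auto simp: word_tr_def ydeg_concat_replicate diag_concat_replicate power_0_left)
qed

end

text \<open>
  The two roots \<open>\<theta>\<close> and \<open>\<eta>\<close> that split the symbol algebra over the algebraic closure.
\<close>

definition artin_root :: "nat \<Rightarrow> 'f::field \<Rightarrow> 'f alg_closure"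
  where "artin_root p a = (SOME t. t ^ p - t = to_ac a)"

definition radical_root :: "nat \<Rightarrow> 'f::field \<Rightarrow> 'f alg_closure"
  where "radical_root p b = (SOME t. t ^ p = to_ac b)"

lemma artin_root: "p \<ge> 2 \<Longrightarrow> artin_root p a ^ p - artin_root p a = to_ac a"
proof -
  assume p: "p \<ge> 2"
  let ?f = "monom 1 p - [:to_ac a, 1:]"
  have "degree [:to_ac a, 1:] < degree (monom (1 :: 'a alg_closure) p)"
    using p by (simp add: degree_monom_eq)
  then have "degree ?f = p"
    by (subst diff_conv_add_uminus, subst degree_add_eq_left) (simp_all add: degree_monom_eq)
  then obtain t where "poly ?f t = 0"
    using p alg_closed_imp_poly_has_root[of ?f] by auto
  then have "t ^ p - t = to_ac a"
    by (simp add: poly_monom algebra_simps)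
  then show ?thesis
    unfolding artin_root_def by (rule someI)
qed

lemma radical_root: "p > 0 \<Longrightarrow> radical_root p b ^ p = to_ac b"
  unfolding radical_root_def by (rule someI_ex) (metis nth_root_exists)

context symbol_setting
begin

abbreviation "wtr \<equiv> word_tr (artin_root p a) (radical_root p b) p"

text \<open>
  The trace of the matrix representation, defined on the free algebra as the linear extension of the
  trace on words.
\<close>

definition algtr :: "'f free_alg \<Rightarrow> 'f alg_closure"
  where "algtr u = (\<Sum>w\<in>Poly_Mapping.keys u. to_ac (Poly_Mapping.lookup u w) * wtr (letters w))"

lemma char_ac: "CHAR('f alg_closure) = p"
  by (simp add: char_p)

lemma algtr_superset:
  assumes "finite W" "Poly_Mapping.keys u \<subseteq> W"
  shows "algtr u = (\<Sum>w\<in>W. to_ac (Poly_Mapping.lookup u w) * wtr (letters w))"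
  unfolding algtr_def by (rule sum.mono_neutral_left) (use assms in \<open>auto simp: in_keys_iff\<close>)

lemma algtr_add: "algtr (u + v) = algtr u + algtr v"
proof -
  let ?W = "Poly_Mapping.keys u \<union> Poly_Mapping.keys v"
  have "Poly_Mapping.keys (u + v) \<subseteq> ?W" by (rule Poly_Mapping.keys_add)
  then show ?thesis
    by (simp add: algtr_superset[of ?W] lookup_add distrib_right sum.distrib)
qed

lemma algtr_single: "algtr (Poly_Mapping.single w c) = to_ac c * wtr (letters w)"
  by (subst algtr_superset[of "{w}"]) auto

lemma algtr_commute: "algtr (u * v) = algtr (v * u)"
proof (induction u rule: free_alg_induct)
  case (1 w c)
  show ?case
  proof (induction v rule: free_alg_induct)
    case (1 w' c')
    show ?case
      by (simp add: mult_single algtr_single mult.commute word_tr_commute[OF p char_ac, where u = "letters w"])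
  qed (simp add: distrib_left distrib_right algtr_add)
qed (simp add: distrib_left distrib_right algtr_add)

sublocale algtr: trace_form algtr
  by standard (simp_all add: algtr_add algtr_commute)

lemma algtr_scalar: "algtr (free_scalar c * u) = to_ac c * algtr u"
  by (induction u rule: free_alg_induct)
     (simp_all add: free_scalar_def mult_single algtr_single mult.assoc algtr_add distrib_left)

lemma algtr_power: "algtr (u ^ p) = algtr u ^ p"
proof (induction u rule: free_alg_induct)
  case (1 w c)
  show ?case
    by (simp add: single_power algtr_single word_tr_power[OF p char_ac] power_mult_distrib)
next
  case (2 u v)
  have "(algtr u + algtr v) ^ p = algtr u ^ p + algtr v ^ p"
    by (rule freshmans_dream) (simp_all add: p char_p)
  then show ?case
    using 2 algtr.tr_power_char_add[OF p char_ac, of u v] by (simp add: algtr_add)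
qed

lemma algtr_rels:
  assumes "r \<in> symbol_rels p a b"
  shows "algtr (r * u) = 0"
proof (induction u rule: free_alg_induct)
  case (1 w c)
  let ?\<theta> = "artin_root p a" and ?\<eta> = "radical_root p b"
  have p0: "p > 0" using p2 by simp
  have th: "(?\<theta> + of_nat n) ^ p = ?\<theta> + of_nat n + to_ac a" for n
  proof (induction n)
    case 0
    show ?case using artin_root[OF p2, of a] by (simp add: algebra_simps)
  next
    case (Suc n)
    have "(?\<theta> + of_nat n + 1) ^ p = (?\<theta> + of_nat n) ^ p + 1 ^ p"
      by (rule freshmans_dream) (simp_all add: p char_p)
    then show ?case using Suc by (simp add: algebra_simps)
  qed
  have per: "diag ?\<theta> ?\<eta> w (n + p) = diag ?\<theta> ?\<eta> w n" for w n
    by (rule diag_periodic[OF p char_ac])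
  let ?w = "Poly_Mapping.single w c"
  let ?d = "diag ?\<theta> ?\<eta> (letters w)"
  have words: "gx ^ p * ?w = Poly_Mapping.single (Word (replicate p Gen_x @ letters w)) c"
    "gx * ?w = Poly_Mapping.single (Word (Gen_x # letters w)) c"
    "gy ^ p * ?w = Poly_Mapping.single (Word (replicate p Gen_y @ letters w)) c"
    "gy * ?w = Poly_Mapping.single (Word (Gen_y # letters w)) c"
    "gy * gx * ?w = Poly_Mapping.single (Word (Gen_y # Gen_x # letters w)) c"
    "gx * gy * ?w = Poly_Mapping.single (Word (Gen_x # Gen_y # letters w)) c"
    unfolding free_x_power free_y_power unfolding free_x_def free_y_def
    by (simp_all add: mult_single plus_gen_word_def)
  have "wtr (replicate p Gen_x @ letters w) = wtr (Gen_x # letters w) + to_ac a * wtr (letters w)"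
    by (simp add: word_tr_def ydeg_append ydeg_replicate diag_append diag_replicate th
        distrib_right sum.distrib sum_distrib_left)
  then have "algtr (gx ^ p * ?w) = algtr (gx * ?w) + algtr (free_scalar a * ?w)"
    by (simp add: words algtr_scalar algtr_single distrib_left mult.left_commute)
  moreover have "wtr (replicate p Gen_y @ letters w) = to_ac b * wtr (letters w)"
    by (simp add: word_tr_def ydeg_append ydeg_replicate diag_append diag_replicate per
        radical_root[OF p0] sum_distrib_left)
  then have "algtr (gy ^ p * ?w) = algtr (free_scalar b * ?w)"
    by (simp add: words algtr_scalar algtr_single mult.left_commute)
  moreover have "wtr (Gen_y # Gen_x # letters w) = wtr (Gen_x # Gen_y # letters w) + wtr (Gen_y # letters w)"
    by (simp add: word_tr_def distrib_left distrib_right sum.distrib mult_ac)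
  then have "algtr (gy * gx * ?w) = algtr (gx * gy * ?w) + algtr (gy * ?w)"
    by (simp add: words algtr_single distrib_left)
  ultimately show ?case
    using assms by (auto simp: symbol_rels_def left_diff_distrib distrib_right
      algtr.tr_diff algtr_add)
qed (simp add: distrib_left algtr_add)

text \<open>
  The trace form descends to the symbol algebra: the elements \<open>u\<close> for which all \<open>v u w\<close> have trace zero
  form an ideal, which contains the relations.
\<close>

lemma algtr_ideal:
  assumes "u \<in> sI"
  shows "algtr u = 0"
proof -
  let ?Z = "{u. \<forall>v w. algtr (v * u * w) = 0}"
  have "ideal ?Z (free_algebra :: 'f free_alg ring)"
  proof (rule idealI[OF ring_free_algebra])
    show "subgroup ?Z (add_monoid (free_algebra :: 'f free_alg ring))"
    proof
      fix u :: "'f free_alg" assume u: "u \<in> ?Z"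
      interpret R: ring "free_algebra :: 'f free_alg ring" by (rule ring_free_algebra)
      have "inv\<^bsub>add_monoid (free_algebra :: 'f free_alg ring)\<^esub> u = - u"
        using R.minus_equality[of "- u" u] by (simp add: a_inv_def)
      then show "inv\<^bsub>add_monoid (free_algebra :: 'f free_alg ring)\<^esub> u \<in> ?Z"
        using u by (simp add: algtr.tr_minus)
    qed (auto simp: distrib_left distrib_right algtr_add algtr.tr_0)
    show "x \<otimes>\<^bsub>free_algebra\<^esub> u \<in> ?Z" "u \<otimes>\<^bsub>free_algebra\<^esub> x \<in> ?Z"
      if "u \<in> ?Z" for u x :: "'f free_alg"
      using that by (simp_all add: mult.assoc) (simp add: mult.assoc[symmetric])
  qed
  moreover have "symbol_rels p a b \<subseteq> ?Z"
  proof (intro subsetI CollectI allI)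
    fix r v w :: "'f free_alg" assume r: "r \<in> symbol_rels p a b"
    have "algtr (v * r * w) = algtr (r * (w * v))"
      using algtr_commute[of v "r * w"] by (simp add: mult.assoc)
    then show "algtr (v * r * w) = 0" using algtr_rels[OF r] by simp
  qed
  ultimately have "sI \<subseteq> ?Z"
    unfolding symbol_ideal_def by (rule ring.genideal_minimal[OF ring_free_algebra])
  then have "algtr (1 * u * 1) = 0" using assms by blast
  then show ?thesis by simp
qed

lemma algtr_cong: "u - v \<in> sI \<Longrightarrow> algtr u = algtr v"
  using algtr_ideal[of "u - v"] by (simp add: algtr.tr_diff)

lemma algtr_monomial:
  "\<not> p dvd j \<Longrightarrow> algtr (gx ^ i * gy ^ j) = 0"
  "i < p - 1 \<Longrightarrow> algtr (gx ^ i) = 0"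
  "algtr (gx ^ (p - 1)) = - 1"
  using power_sum_char[where \<theta> = "artin_root p a", OF p char_ac]
  by (simp_all add: free_x_power free_y_power mult_single algtr_single word_tr_def ydeg_append
      ydeg_replicate diag_append diag_replicate)

lemma ideal_power_cong: "u - v \<in> sI \<Longrightarrow> u ^ n - v ^ n \<in> sI"
proof (induction n)
  case (Suc n)
  have "u ^ Suc n - v ^ Suc n = u * (u ^ n - v ^ n) + (u - v) * v ^ n"
    by (simp add: algebra_simps)
  then show ?case using Suc by (simp only: ideal_add ideal_mult_left ideal_mult_right)
qed (simp add: ideal_0)

text \<open>
  The trace condition on \<open>p\<close>-central elements that drives the upper bound.
\<close>

lemma algtr_power_pred:
  assumes "u ^ p - free_scalar c \<in> sI"
  shows "algtr (u ^ (p - 1)) = 0"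
proof -
  \<comment> \<open>the unit matrix has trace \<open>p = 0\<close>\<close>
  have "algtr 1 = 0"
    using algtr_monomial(2)[of 0] p2 by simp
  then have "algtr (free_scalar (c ^ (p - 1))) = 0"
    using algtr_scalar[of "c ^ (p - 1)" 1] by simp
  moreover have "(u ^ p) ^ (p - 1) - free_scalar c ^ (p - 1) \<in> sI"
    by (rule ideal_power_cong) (rule assms)
  ultimately have "algtr ((u ^ p) ^ (p - 1)) = 0"
    by (simp add: algtr_cong free_scalar_simps)
  moreover have "(u ^ p) ^ (p - 1) = (u ^ (p - 1)) ^ p"
    by (metis mult.commute power_mult)
  ultimately show ?thesis by (simp add: algtr_power)
qed

end

section \<open>Degrees and the filtration they define\<close>

text \<open>
  Degrees take values in \<open>\<int> \<times> \<int>\<close> with the lexicographic order, in which the second component dominates.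
  The pair \<open>(m, n)\<close> is encoded as the integer polynomial \<open>m + n \<omega>\<close>: polynomials are ordered by the
  sign of their leading coefficient, which makes \<open>\<omega>\<close> infinitely large, and the ordered ring
  structure is available for computing with multiples. The order is discrete, so a degree less than
  \<open>\<gamma>\<close> is at most \<open>\<gamma> - 1\<close>.
\<close>

lemma int_poly_discrete:
  fixes x y :: "int poly"
  assumes "x < y"
  shows "x \<le> y - 1"
proof (cases "degree (y - x)")
  case 0
  then obtain c where c: "y - x = [:c:]" by (metis degree_eq_zeroE)
  then have "c > 0" using assms by (simp add: less_poly_def pos_poly_pCons)
  moreover have "y - 1 - x = [:c - 1:]" using c by (simp add: algebra_simps one_pCons)
  ultimately show ?thesis
    by (cases "c = 1") (auto simp: less_eq_poly_def pos_poly_pCons algebra_simps)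
next
  case (Suc n)
  have "lead_coeff (y - 1 - x) = lead_coeff (y - x)"
    using lead_coeff_add_le[of "- 1" "y - x"] Suc by (simp add: algebra_simps)
  then show ?thesis
    using assms by (simp add: less_poly_def less_eq_poly_def pos_poly_def)
qed

abbreviation omega :: "int poly" where "omega \<equiv> [:0, 1:]"

text \<open>
  The degree of the monomial \<open>x\<^sup>i y\<^sup>j\<close>. All degrees in the algebra are multiplied by \<open>p\<close>, so that \<open>x\<close>
  and \<open>y\<close> get the integral degrees \<open>1\<close> and \<open>\<omega>\<close>, and a scalar \<open>c\<close> gets \<open>p\<close> times its degree.
\<close>

definition wt :: "nat \<Rightarrow> nat \<Rightarrow> int poly"
  where "wt i j = of_nat i + of_nat j * omega"

lemma wt_add: "wt (i + k) (j + l) = wt i j + wt k l"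
  by (simp add: wt_def algebra_simps)

lemma wt_mult: "wt (n * i) (n * j) = of_nat n * wt i j"
  by (simp add: wt_def algebra_simps)

lemma wt_Suc: "wt (Suc i) j = wt i j + 1" "wt i (Suc j) = wt i j + omega" "wt 0 0 = 0"
  by (simp_all add: wt_def algebra_simps)

lemma wt_p: "wt (p + i) j = wt i j + of_nat p" "wt i (p + j) = wt i j + of_nat p * omega"
  by (simp_all add: wt_def algebra_simps)

text \<open>
  Terms of a linear combination of the monomials \<open>x\<^sup>i y\<^sup>j\<close> with \<open>i, j < p\<close> have different degrees, since
  the exponents can be read off modulo \<open>p\<close>.
\<close>

lemma wt_unique:
  assumes "of_nat p * c + wt i j = of_nat p * d + wt k l" "i < p" "j < p" "k < p" "l < p"
  shows "i = k \<and> j = l"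
proof -
  have co: "coeff (of_nat p * q + wt i j) 0 = int p * coeff q 0 + int i"
    "coeff (of_nat p * q + wt i j) 1 = int p * coeff q 1 + int j" for q i j
    by (simp_all add: wt_def of_nat_poly)
  have *: "x = y" if "int p * m + int x = int p * n + int y" "x < p" "y < p" for x y m n
  proof -
    have "(int p * m + int x) mod int p = (int p * n + int y) mod int p" using that(1) by simp
    then show ?thesis using that(2,3) by simp
  qed
  show ?thesis
    using assms * co by metis
qed

text \<open>
  A degree function is the negative of a valuation; its value at zero is irrelevant.
\<close>

definition degree_function :: "('a::idom \<Rightarrow> int poly) \<Rightarrow> bool"
  where "degree_function d \<longleftrightarrow>
    (\<forall>x y. x \<noteq> 0 \<longrightarrow> y \<noteq> 0 \<longrightarrow> d (x * y) = d x + d y) \<and>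
    (\<forall>x y. x \<noteq> 0 \<longrightarrow> y \<noteq> 0 \<longrightarrow> x + y \<noteq> 0 \<longrightarrow> d (x + y) \<le> max (d x) (d y))"

lemma degree_function_1: "degree_function d \<Longrightarrow> d 1 = 0"
  unfolding degree_function_def by (metis add_cancel_right_right mult_1 one_neq_zero)

text \<open>
  A symbol algebra over a field with a degree function for which \<open>a\<close> has degree \<open>(1, 0)\<close> and \<open>b\<close> has
  degree \<open>(0, 1)\<close>.
\<close>

locale graded_setting = symbol_setting p a b for p :: nat and a b :: "'f::field" +
  fixes \<delta> :: "'f \<Rightarrow> int poly"
  assumes degree_function: "degree_function \<delta>"
    and a: "a \<noteq> 0" and delta_a: "\<delta> a = 1" and delta_b: "\<delta> b = omega"
begin

lemma delta_mult: "c \<noteq> 0 \<Longrightarrow> d \<noteq> 0 \<Longrightarrow> \<delta> (c * d) = \<delta> c + \<delta> d"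
  and delta_add: "c \<noteq> 0 \<Longrightarrow> d \<noteq> 0 \<Longrightarrow> c + d \<noteq> 0 \<Longrightarrow> \<delta> (c + d) \<le> max (\<delta> c) (\<delta> d)"
  using degree_function by (simp_all add: degree_function_def)

text \<open>
  The scalar \<open>c\<close> has degree at most \<open>\<gamma>\<close> on the scale of the algebra; zero has degree \<open>-\<infinity>\<close>.
\<close>

definition scalar_le :: "'f \<Rightarrow> int poly \<Rightarrow> bool"
  where "scalar_le c \<gamma> \<longleftrightarrow> c = 0 \<or> of_nat p * \<delta> c \<le> \<gamma>"

lemma delta_1: "\<delta> 1 = 0"
  using delta_mult[of 1 1] by simp

lemma delta_minus_1: "\<delta> (- 1) = 0"
proof -
  have "2 * \<delta> (- 1) = 0" using delta_mult[of "- 1" "- 1"] delta_1 by simp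
  then show ?thesis by simp
qed

lemma delta_power: "c \<noteq> 0 \<Longrightarrow> \<delta> (c ^ n) = of_nat n * \<delta> c"
  by (induction n) (simp_all add: delta_1 delta_mult algebra_simps)

lemma scalar_le_0: "scalar_le 0 \<gamma>" by (simp add: scalar_le_def)

lemma scalar_le_1: "scalar_le 1 0" by (simp add: scalar_le_def delta_1)

lemma scalar_le_mono: "scalar_le c \<gamma> \<Longrightarrow> \<gamma> \<le> \<gamma>' \<Longrightarrow> scalar_le c \<gamma>'" by (auto simp: scalar_le_def)

lemma scalar_le_add: "scalar_le c \<gamma> \<Longrightarrow> scalar_le d \<gamma> \<Longrightarrow> scalar_le (c + d) \<gamma>"
proof -
  assume cd: "scalar_le c \<gamma>" "scalar_le d \<gamma>"
  show ?thesis
  proof (cases "c = 0 \<or> d = 0 \<or> c + d = 0")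
    case False
    then have "of_nat p * \<delta> (c + d) \<le> of_nat p * max (\<delta> c) (\<delta> d)"
      by (intro mult_left_mono delta_add) auto
    also have "\<dots> \<le> \<gamma>" using cd False by (auto simp: scalar_le_def max_def)
    finally show ?thesis by (simp add: scalar_le_def)
  qed (use cd in \<open>auto simp: scalar_le_def\<close>)
qed

lemma scalar_le_mult: "scalar_le c \<gamma> \<Longrightarrow> scalar_le d \<gamma>' \<Longrightarrow> scalar_le (c * d) (\<gamma> + \<gamma>')"
  using add_mono[of "of_nat p * \<delta> c" \<gamma> "of_nat p * \<delta> d" \<gamma>']
  by (cases "c = 0 \<or> d = 0") (auto simp: scalar_le_def delta_mult distrib_left)

lemma scalar_le_minus_1: "scalar_le (- 1) 0" by (simp add: scalar_le_def delta_minus_1)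

lemma scalar_le_of_nat: "scalar_le (of_nat n) 0"
  by (induction n) (auto simp: scalar_le_0 intro!: scalar_le_add scalar_le_1)

lemma scalar_le_a: "scalar_le a (of_nat p)" by (simp add: scalar_le_def delta_a)

lemma scalar_le_b: "scalar_le b (of_nat p * omega)" by (simp add: scalar_le_def delta_b)

text \<open>
  The linear combination of the monomials \<open>x\<^sup>i y\<^sup>j\<close> with \<open>i, j < p\<close> that has the coefficients \<open>c i j\<close>.
\<close>

definition basis_sum :: "(nat \<Rightarrow> nat \<Rightarrow> 'f) \<Rightarrow> 'f free_alg"
  where "basis_sum c = (\<Sum>i<p. \<Sum>j<p. free_scalar (c i j) * (gx ^ i * gy ^ j))"

text \<open>
  The elements that are congruent, modulo the ideal, to a linear combination of these monomials all of
  whose terms have degree at most \<open>\<gamma>\<close>.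
\<close>

definition Fil :: "int poly \<Rightarrow> 'f free_alg set"
  where "Fil \<gamma> = {u. \<exists>c. u - basis_sum c \<in> sI \<and> (\<forall>i<p. \<forall>j<p. scalar_le (c i j) (\<gamma> - wt i j))}"

lemma basis_sum_add: "basis_sum (\<lambda>i j. c i j + d i j) = basis_sum c + basis_sum d"
  by (simp add: basis_sum_def free_scalar_simps distrib_right sum.distrib)

lemma basis_sum_scalar: "basis_sum (\<lambda>i j. d * c i j) = free_scalar d * basis_sum c"
  by (simp add: basis_sum_def free_scalar_simps sum_distrib_left mult.assoc)

lemma basis_sum_delta:
  assumes "i < p" "j < p"
  shows "basis_sum (\<lambda>k l. if k = i \<and> l = j then c else 0) = free_scalar c * (gx ^ i * gy ^ j)"
proof -
  have "free_scalar (if k = i \<and> l = j then c else 0) * m =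
      (if k = i then if l = j then free_scalar c * m else 0 else 0)" for k l m
    by (simp add: free_scalar_simps)
  then have "basis_sum (\<lambda>k l. if k = i \<and> l = j then c else 0) =
      (\<Sum>k<p. if k = i then \<Sum>l<p. if l = j then free_scalar c * (gx ^ k * gy ^ l) else 0 else 0)"
    unfolding basis_sum_def by (intro sum.cong refl) simp
  then show ?thesis using assms by simp
qed

lemma Fil_ideal: "u \<in> sI \<Longrightarrow> u \<in> Fil \<gamma>"
  unfolding Fil_def by (intro CollectI exI[of _ "\<lambda>_ _. 0"]) (simp add: basis_sum_def free_scalar_simps scalar_le_0)

lemma Fil_0: "0 \<in> Fil \<gamma>"
  by (rule Fil_ideal) (rule ideal_0)

lemma Fil_add: "u \<in> Fil \<gamma> \<Longrightarrow> v \<in> Fil \<gamma> \<Longrightarrow> u + v \<in> Fil \<gamma>"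
proof -
  assume "u \<in> Fil \<gamma>" "v \<in> Fil \<gamma>"
  then obtain c d where c: "u - basis_sum c \<in> sI" "\<forall>i<p. \<forall>j<p. scalar_le (c i j) (\<gamma> - wt i j)"
    and d: "v - basis_sum d \<in> sI" "\<forall>i<p. \<forall>j<p. scalar_le (d i j) (\<gamma> - wt i j)"
    by (auto simp: Fil_def)
  have "u + v - basis_sum (\<lambda>i j. c i j + d i j) \<in> sI"
    using ideal_add[OF c(1) d(1)] by (simp add: basis_sum_add algebra_simps)
  then show ?thesis
    unfolding Fil_def using c(2) d(2) scalar_le_add by blast
qed

lemma Fil_mono: "u \<in> Fil \<gamma> \<Longrightarrow> \<gamma> \<le> \<gamma>' \<Longrightarrow> u \<in> Fil \<gamma>'"
  unfolding Fil_def using scalar_le_mono[OF _ diff_right_mono[of \<gamma> \<gamma>']] by blast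

lemma Fil_scalar: "scalar_le d \<gamma>' \<Longrightarrow> u \<in> Fil \<gamma> \<Longrightarrow> free_scalar d * u \<in> Fil (\<gamma>' + \<gamma>)"
proof -
  assume d: "scalar_le d \<gamma>'" and "u \<in> Fil \<gamma>"
  then obtain c where c: "u - basis_sum c \<in> sI" "\<forall>i<p. \<forall>j<p. scalar_le (c i j) (\<gamma> - wt i j)"
    by (auto simp: Fil_def)
  have "free_scalar d * u - basis_sum (\<lambda>i j. d * c i j) \<in> sI"
    using ideal_mult_left[OF c(1), of "free_scalar d"]
    by (simp add: basis_sum_scalar right_diff_distrib)
  moreover have "scalar_le (d * c i j) (\<gamma>' + \<gamma> - wt i j)" if "i < p" "j < p" for i j
    using scalar_le_mult[OF d, of "c i j" "\<gamma> - wt i j"] c(2) that by (simp add: add_diff_eq)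
  ultimately show ?thesis
    unfolding Fil_def by blast
qed

lemma Fil_minus: "u \<in> Fil \<gamma> \<Longrightarrow> - u \<in> Fil \<gamma>"
  using Fil_scalar[OF scalar_le_minus_1, of u \<gamma>] by (simp add: free_scalar_simps)

lemma Fil_diff: "u \<in> Fil \<gamma> \<Longrightarrow> v \<in> Fil \<gamma> \<Longrightarrow> u - v \<in> Fil \<gamma>"
  using Fil_add[of u \<gamma> "- v"] Fil_minus[of v] by simp

lemma Fil_sum: "(\<And>x. x \<in> A \<Longrightarrow> f x \<in> Fil \<gamma>) \<Longrightarrow> sum f A \<in> Fil \<gamma>"
  by (induction A rule: infinite_finite_induct) (auto simp: Fil_0 Fil_add)

lemma Fil_cong: "u - v \<in> sI \<Longrightarrow> v \<in> Fil \<gamma> \<Longrightarrow> u \<in> Fil \<gamma>"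
  using Fil_add[of "u - v" \<gamma> v] Fil_ideal[of "u - v" \<gamma>] by simp

lemma Fil_basis: "i < p \<Longrightarrow> j < p \<Longrightarrow> gx ^ i * gy ^ j \<in> Fil (wt i j)"
  unfolding Fil_def
  by (intro CollectI exI[of _ "\<lambda>k l. if k = i \<and> l = j then 1 else 0"])
     (simp add: basis_sum_delta free_scalar_simps ideal_0 scalar_le_0 scalar_le_1)

lemma reduce_x: "gx ^ (p + i) * gy ^ j - (gx ^ Suc i * gy ^ j + free_scalar a * (gx ^ i * gy ^ j)) \<in> sI"
proof -
  have "(gx ^ p - gx - free_scalar a) * (gx ^ i * gy ^ j) \<in> sI"
    by (intro ideal_mult_right ideal_rels)
  then show ?thesis by (simp add: left_diff_distrib distrib_right power_add mult.assoc diff_diff_eq)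
qed

lemma reduce_y: "gx ^ i * gy ^ (p + j) - free_scalar b * (gx ^ i * gy ^ j) \<in> sI"
proof -
  have "gx ^ i * ((gy ^ p - free_scalar b) * gy ^ j) \<in> sI"
    by (intro ideal_mult_left ideal_mult_right ideal_rels)
  moreover have "gx ^ i * (free_scalar b * gy ^ j) = free_scalar b * (gx ^ i * gy ^ j)"
    by (metis free_scalar_commute mult.assoc)
  ultimately show ?thesis
    by (simp add: left_diff_distrib right_diff_distrib power_add mult.assoc)
qed

lemma Fil_monomial: "gx ^ i * gy ^ j \<in> Fil (wt i j)"
proof (induction j arbitrary: i rule: less_induct)
  case (less j)
  show ?case
  proof (cases "j < p")
    case True
    show ?thesis
    proof (induction i rule: less_induct)
      case (less i)
      show ?case
      proof (cases "i < p")
        case False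
        then obtain k where i: "i = p + k" using le_Suc_ex not_less by blast
        have "free_scalar a * (gx ^ k * gy ^ j) \<in> Fil (wt i j)"
          using Fil_scalar[OF scalar_le_a less[of k]] p2 unfolding i wt_p add.commute[of "wt k j"] by simp
        moreover have "gx ^ Suc k * gy ^ j \<in> Fil (wt i j)"
          by (rule Fil_mono[OF less[of "Suc k"]]) (use i p2 in \<open>auto simp: wt_p wt_Suc\<close>)
        ultimately show ?thesis
          unfolding i by (intro Fil_cong[OF reduce_x] Fil_add) (simp_all add: i)
      qed (use \<open>j < p\<close> Fil_basis in auto)
    qed
  next
    case False
    then obtain k where j: "j = p + k" using le_Suc_ex not_less by blast
    have "free_scalar b * (gx ^ i * gy ^ k) \<in> Fil (wt i j)"
      using Fil_scalar[OF scalar_le_b less[of k i]] p2 unfolding j wt_p add.commute[of "wt i k"] by simp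
    then show ?thesis
      unfolding j by (rule Fil_cong[OF reduce_y])
  qed
qed

text \<open>
  Replacing \<open>x\<close> by \<open>x + n\<close> changes a monomial only in smaller degree. Hence, in the next lemma, monomials
  multiply like monomials in commuting variables up to terms of smaller degree.
\<close>

lemma Fil_shift: "gx ^ i * (gx + of_nat n) ^ k * gy ^ l - gx ^ (i + k) * gy ^ l \<in> Fil (wt (i + k) l - 1)"
proof (induction k arbitrary: i)
  case (Suc k)
  have of_nat: "gx ^ i * (of_nat n * (gx + of_nat n) ^ k) * gy ^ l =
      free_scalar (of_nat n) * (gx ^ i * (gx + of_nat n) ^ k * gy ^ l)"
    by (simp add: free_scalar_def) (metis mult.assoc mult_of_nat_commute)
  have "gx ^ i * (gx + of_nat n) ^ k * gy ^ l \<in> Fil (wt (i + k) l)"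
    using Fil_add[OF Fil_mono[OF Suc[of i], of "wt (i + k) l"] Fil_monomial[of "i + k" l]] by simp
  then have "free_scalar (of_nat n) * (gx ^ i * (gx + of_nat n) ^ k * gy ^ l) \<in> Fil (wt (i + Suc k) l - 1)"
    using Fil_scalar[OF scalar_le_of_nat] by (fastforce simp: wt_Suc)
  note Fil_add[OF this Suc[of "Suc i", unfolded add_Suc_shift]]
  moreover have "gx ^ i * (gx + of_nat n) ^ Suc k * gy ^ l =
      gx ^ i * (of_nat n * (gx + of_nat n) ^ k) * gy ^ l + gx ^ Suc i * (gx + of_nat n) ^ k * gy ^ l"
    unfolding power_Suc[of "gx + of_nat n"] power_Suc2[of gx i]
    by (simp only: distrib_left distrib_right mult.assoc add.commute)
  ultimately show ?case
    unfolding of_nat by (simp only: add_diff_eq)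
qed (simp add: Fil_0)

lemma Fil_monomial_mult:
  "(gx ^ i * gy ^ j) * (gx ^ k * gy ^ l) - gx ^ (i + k) * gy ^ (j + l) \<in> Fil (wt (i + k) (j + l) - 1)"
proof -
  have "gx ^ i * (gy ^ j * gx ^ k - (gx + of_nat j) ^ k * gy ^ j) * gy ^ l \<in> sI"
    by (intro ideal_mult_left ideal_mult_right gy_power_gx_power)
  from Fil_add[OF Fil_ideal[OF this] Fil_shift[of i j k "j + l"]]
  show ?thesis by (simp add: left_diff_distrib right_diff_distrib mult.assoc power_add)
qed

lemma Fil_mult: "u \<in> Fil \<gamma> \<Longrightarrow> v \<in> Fil \<gamma>' \<Longrightarrow> u * v \<in> Fil (\<gamma> + \<gamma>')"
proof -
  assume "u \<in> Fil \<gamma>" "v \<in> Fil \<gamma>'"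
  then obtain c d where c: "u - basis_sum c \<in> sI" "\<forall>i<p. \<forall>j<p. scalar_le (c i j) (\<gamma> - wt i j)"
    and d: "v - basis_sum d \<in> sI" "\<forall>i<p. \<forall>j<p. scalar_le (d i j) (\<gamma>' - wt i j)"
    by (auto simp: Fil_def)
  have mon: "free_scalar (c i j) * (gx ^ i * gy ^ j) * (free_scalar (d k l) * (gx ^ k * gy ^ l)) \<in> Fil (\<gamma> + \<gamma>')"
    if ij: "i < p" "j < p" and kl: "k < p" "l < p" for i j k l
  proof -
    have "(gx ^ i * gy ^ j) * (gx ^ k * gy ^ l) \<in> Fil (wt (i + k) (j + l))"
      using Fil_add[OF Fil_mono[OF Fil_monomial_mult] Fil_monomial[of "i + k" "j + l"], of i k j l]
      by simp
    moreover have "scalar_le (c i j * d k l) ((\<gamma> - wt i j) + (\<gamma>' - wt k l))"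
      using c(2) d(2) ij kl by (intro scalar_le_mult) auto
    ultimately have "free_scalar (c i j * d k l) * ((gx ^ i * gy ^ j) * (gx ^ k * gy ^ l)) \<in>
        Fil ((\<gamma> - wt i j) + (\<gamma>' - wt k l) + wt (i + k) (j + l))"
      by (intro Fil_scalar)
    moreover have "free_scalar (c i j) * (gx ^ i * gy ^ j) * (free_scalar (d k l) * (gx ^ k * gy ^ l)) =
        free_scalar (c i j * d k l) * ((gx ^ i * gy ^ j) * (gx ^ k * gy ^ l))"
      by (rule free_scalar_mult_mult)
    ultimately show ?thesis by (simp add: wt_add)
  qed
  have "basis_sum c * basis_sum d \<in> Fil (\<gamma> + \<gamma>')"
    unfolding basis_sum_def sum_product sum_distrib_left sum_distrib_right
    by (intro Fil_sum mon) auto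
  moreover have "u * v - basis_sum c * basis_sum d = (u - basis_sum c) * v + basis_sum c * (v - basis_sum d)"
    by (simp add: algebra_simps)
  ultimately show ?thesis
    using Fil_cong[of "u * v" "basis_sum c * basis_sum d"]
      ideal_add[OF ideal_mult_right[OF c(1), of v] ideal_mult_left[OF d(1), of "basis_sum c"]]
    by simp
qed

section \<open>Leading terms\<close>

text \<open>
  Up to terms of degree less than \<open>\<gamma>\<close>, the element \<open>u\<close> is \<open>e x\<^sup>i y\<^sup>j\<close>, a term of degree at most \<open>\<gamma>\<close>.
  The exponents may exceed \<open>p\<close>, and \<open>e = 0\<close> is allowed, so that the relation is closed under sums and
  products even if leading terms cancel.
\<close>

definition Lead :: "int poly \<Rightarrow> nat \<Rightarrow> nat \<Rightarrow> 'f \<Rightarrow> 'f free_alg \<Rightarrow> bool"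
  where "Lead \<gamma> i j e u \<longleftrightarrow>
    scalar_le e (\<gamma> - wt i j) \<and> u - free_scalar e * (gx ^ i * gy ^ j) \<in> Fil (\<gamma> - 1)"

lemma Lead_Fil: "Lead \<gamma> i j e u \<Longrightarrow> u \<in> Fil \<gamma>"
proof -
  assume u: "Lead \<gamma> i j e u"
  have "free_scalar e * (gx ^ i * gy ^ j) \<in> Fil (\<gamma> - wt i j + wt i j)"
    by (intro Fil_scalar Fil_monomial) (use u in \<open>simp add: Lead_def\<close>)
  moreover have "u - free_scalar e * (gx ^ i * gy ^ j) \<in> Fil \<gamma>"
    by (rule Fil_mono[of _ "\<gamma> - 1"]) (use u in \<open>simp_all add: Lead_def\<close>)
  ultimately show ?thesis
    using Fil_add[of "u - free_scalar e * (gx ^ i * gy ^ j)" \<gamma> "free_scalar e * (gx ^ i * gy ^ j)"]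
    by simp
qed

lemma Lead_0: "Lead \<gamma> i j 0 0"
  by (simp add: Lead_def scalar_le_0 free_scalar_simps Fil_0)

lemma Lead_1: "Lead 0 0 0 1 1"
  by (simp add: Lead_def scalar_le_1 free_scalar_simps Fil_0 wt_Suc)

lemma Lead_add: "Lead \<gamma> i j e u \<Longrightarrow> Lead \<gamma> i j f v \<Longrightarrow> Lead \<gamma> i j (e + f) (u + v)"
proof -
  assume *: "Lead \<gamma> i j e u" "Lead \<gamma> i j f v"
  let ?m = "gx ^ i * gy ^ j"
  have "(u - free_scalar e * ?m) + (v - free_scalar f * ?m) \<in> Fil (\<gamma> - 1)"
    by (intro Fil_add) (use * in \<open>simp_all add: Lead_def\<close>)
  moreover have "(u - free_scalar e * ?m) + (v - free_scalar f * ?m) = u + v - free_scalar (e + f) * ?m"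
    by (simp add: free_scalar_simps distrib_right)
  ultimately show ?thesis
    using * by (simp only: Lead_def scalar_le_add simp_thms)
qed

lemma Lead_mult:
  assumes "Lead \<gamma> i j e u" "Lead \<gamma>' k l f v"
  shows "Lead (\<gamma> + \<gamma>') (i + k) (j + l) (e * f) (u * v)"
proof -
  let ?m = "gx ^ i * gy ^ j" and ?n = "gx ^ k * gy ^ l"
  let ?e = "free_scalar e" and ?f = "free_scalar f"
  have le: "scalar_le (e * f) (\<gamma> + \<gamma>' - wt (i + k) (j + l))"
    using scalar_le_mult[of e "\<gamma> - wt i j" f "\<gamma>' - wt k l"] assms by (simp add: Lead_def wt_add algebra_simps)
  have fm: "?e * ?m \<in> Fil \<gamma>"
    using Fil_diff[OF Lead_Fil[OF assms(1)] Fil_mono[of "u - ?e * ?m" "\<gamma> - 1" \<gamma>]] assms(1)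
    by (simp add: Lead_def)
  have 1: "(u - ?e * ?m) * v \<in> Fil (\<gamma> + \<gamma>' - 1)"
    using Fil_mult[of "u - ?e * ?m" "\<gamma> - 1" v \<gamma>'] Lead_Fil[OF assms(2)] assms(1)
    by (simp add: Lead_def add_diff_eq diff_add_eq)
  have 2: "(?e * ?m) * (v - ?f * ?n) \<in> Fil (\<gamma> + \<gamma>' - 1)"
    using Fil_mult[OF fm, of "v - ?f * ?n" "\<gamma>' - 1"] assms(2)
    by (simp add: Lead_def add_diff_eq)
  have "free_scalar (e * f) * (?m * ?n - gx ^ (i + k) * gy ^ (j + l)) \<in>
      Fil (\<gamma> + \<gamma>' - wt (i + k) (j + l) + (wt (i + k) (j + l) - 1))"
    by (intro Fil_scalar Fil_monomial_mult le)
  then have 3: "free_scalar (e * f) * (?m * ?n - gx ^ (i + k) * gy ^ (j + l)) \<in> Fil (\<gamma> + \<gamma>' - 1)"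
    by (simp add: add_diff_eq)
  have "u * v - free_scalar (e * f) * (gx ^ (i + k) * gy ^ (j + l)) =
      ((u - ?e * ?m) * v + (?e * ?m) * (v - ?f * ?n)) +
      free_scalar (e * f) * (?m * ?n - gx ^ (i + k) * gy ^ (j + l))"
    unfolding right_diff_distrib left_diff_distrib free_scalar_mult_mult by simp
  then have "u * v - free_scalar (e * f) * (gx ^ (i + k) * gy ^ (j + l)) \<in> Fil (\<gamma> + \<gamma>' - 1)"
    using Fil_add[OF Fil_add[OF 1 2] 3] by simp
  then show ?thesis
    using le by (simp add: Lead_def)
qed

text \<open>
  Modulo smaller degree the order of the factors is irrelevant, so the mixed term behaves like the
  corresponding term of the binomial formula.
\<close>

lemma Lead_mixed_sum:
  assumes u: "Lead \<gamma> i j e u" and v: "Lead \<gamma>' k l f v"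
  shows "Lead (of_nat r * \<gamma> + of_nat m * \<gamma>') (r * i + m * k) (r * j + m * l)
    (of_nat ((r + m) choose m) * (e ^ r * f ^ m)) (mixed_sum u v (r + m) m)"
proof (induction "r + m" arbitrary: r m)
  case 0
  then show ?case by (simp add: mixed_sum_0 Lead_1)
next
  case (Suc n)
  have 1: "Lead (of_nat r * \<gamma> + of_nat m * \<gamma>') (r * i + m * k) (r * j + m * l)
      (if r = 0 then 0 else of_nat (n choose m) * (e ^ r * f ^ m)) (u * mixed_sum u v n m)"
  proof (cases r)
    case 0
    then show ?thesis using Suc.hyps(2) by (simp add: mixed_sum_gt Lead_0)
  next
    case (Suc s)
    then have "Lead (of_nat s * \<gamma> + of_nat m * \<gamma>') (s * i + m * k) (s * j + m * l)
        (of_nat (n choose m) * (e ^ s * f ^ m)) (mixed_sum u v n m)"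
      using Suc.hyps(1)[of s m] \<open>Suc n = r + m\<close> by simp
    from Lead_mult[OF u this] show ?thesis
      using Suc by (simp add: algebra_simps)
  qed
  have 2: "Lead (of_nat r * \<gamma> + of_nat m * \<gamma>') (r * i + m * k) (r * j + m * l)
      (if m = 0 then 0 else of_nat (n choose (m - 1)) * (e ^ r * f ^ m))
      (if m = 0 then 0 else v * mixed_sum u v n (m - 1))"
  proof (cases m)
    case 0
    then show ?thesis by (simp add: Lead_0)
  next
    case (Suc s)
    then have "Lead (of_nat r * \<gamma> + of_nat s * \<gamma>') (r * i + s * k) (r * j + s * l)
        (of_nat (n choose s) * (e ^ r * f ^ s)) (mixed_sum u v n s)"
      using Suc.hyps(1)[of r s] \<open>Suc n = r + m\<close> by simp
    from Lead_mult[OF v this] show ?thesis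
      using Suc by (simp add: algebra_simps)
  qed
  have "(if r = 0 then 0 else of_nat (n choose m) * (e ^ r * f ^ m)) +
      (if m = 0 then 0 else of_nat (n choose (m - 1)) * (e ^ r * f ^ m)) =
      of_nat ((r + m) choose m) * (e ^ r * f ^ m)"
    using \<open>Suc n = r + m\<close> by (cases m; cases r) (auto simp: algebra_simps)
  then show ?case
    using Lead_add[OF 1 2] by (simp add: mixed_sum_Suc flip: \<open>Suc n = r + m\<close>)
qed

lemma Fil_exists: "\<exists>\<gamma>. u \<in> Fil \<gamma>"
proof (induction u rule: free_alg_induct)
  case (1 w c)
  have x: "gx \<in> Fil (wt 1 0)" and y: "gy \<in> Fil (wt 0 1)"
    using Fil_monomial[of 1 0] Fil_monomial[of 0 1] by simp_all
  have one: "1 \<in> Fil 0" using Lead_Fil[OF Lead_1] .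
  have "\<exists>\<gamma>. Poly_Mapping.single (Word ws) 1 \<in> Fil \<gamma>" for ws
  proof (induction ws)
    case Nil
    show ?case using one by (auto simp flip: zero_gen_word_def)
  next
    case (Cons g ws)
    then obtain \<gamma> where \<gamma>: "Poly_Mapping.single (Word ws) 1 \<in> Fil \<gamma>" by blast
    have "Poly_Mapping.single (Word (g # ws)) (1::'f) =
        (if g = Gen_x then gx else gy) * Poly_Mapping.single (Word ws) 1"
      by (cases g) (simp_all add: free_x_def free_y_def mult_single plus_gen_word_def)
    then show ?case using Fil_mult[OF x \<gamma>] Fil_mult[OF y \<gamma>] by auto
  qed
  then obtain \<gamma> where "Poly_Mapping.single w 1 \<in> Fil \<gamma>" by (metis gen_word.exhaust)
  then have "free_scalar c * Poly_Mapping.single w 1 \<in> Fil (of_nat p * \<delta> c + \<gamma>)"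
    by (intro Fil_scalar) (simp_all add: scalar_le_def)
  then show ?case by (auto simp: free_scalar_def mult_single)
next
  case (2 u v)
  then obtain \<gamma> \<gamma>' where "u \<in> Fil \<gamma>" "v \<in> Fil \<gamma>'" by blast
  then have "u \<in> Fil (max \<gamma> \<gamma>')" "v \<in> Fil (max \<gamma> \<gamma>')" by (auto intro: Fil_mono)
  then show ?case using Fil_add by blast
qed

lemma basis_sum_exists: "\<exists>c. u - basis_sum c \<in> sI"
  using Fil_exists[of u] by (auto simp: Fil_def)

text \<open>
  A nonzero coordinate at which the degree is maximal gives the leading term: by \<open>wt_unique\<close> no other
  term has that degree.
\<close>

lemma Lead_exists:
  assumes u: "u - basis_sum c \<in> sI" and nz: "\<exists>i<p. \<exists>j<p. c i j \<noteq> 0"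
  shows "\<exists>i<p. \<exists>j<p. c i j \<noteq> 0 \<and> Lead (of_nat p * \<delta> (c i j) + wt i j) i j (c i j) u"
proof -
  let ?S = "{s \<in> {..<p} \<times> {..<p}. c (fst s) (snd s) \<noteq> 0}"
  let ?f = "\<lambda>s. of_nat p * \<delta> (c (fst s) (snd s)) + wt (fst s) (snd s)"
  have fin: "finite ?S" and ne: "?S \<noteq> {}" using nz by auto
  obtain s where s: "s \<in> ?S" "?f s = Max (?f ` ?S)"
    using Max_in[of "?f ` ?S"] fin ne by (metis (no_types, lifting) finite_imageI image_iff image_is_empty)
  obtain i j where ij: "s = (i, j)" by (cases s)
  let ?\<gamma> = "of_nat p * \<delta> (c i j) + wt i j"
  have i: "i < p" "j < p" "c i j \<noteq> 0" using s ij by auto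
  have le: "of_nat p * \<delta> (c k l) + wt k l \<le> ?\<gamma>" if "k < p" "l < p" "c k l \<noteq> 0" for k l
  proof -
    have "(k, l) \<in> ?S" using that by simp
    then have "?f (k, l) \<le> Max (?f ` ?S)" by (intro Max_ge finite_imageI fin imageI)
    then show ?thesis using s(2) by (simp only: ij fst_conv snd_conv)
  qed
  let ?d = "\<lambda>k l. c k l + (if k = i \<and> l = j then - c i j else 0)"
  have "scalar_le (?d k l) (?\<gamma> - 1 - wt k l)" if kl: "k < p" "l < p" for k l
  proof (cases "(k = i \<and> l = j) \<or> c k l = 0")
    case False
    then have "of_nat p * \<delta> (c k l) + wt k l \<noteq> ?\<gamma>"
      using wt_unique[of p "\<delta> (c k l)" k l "\<delta> (c i j)" i j] kl i by auto
    then have "of_nat p * \<delta> (c k l) + wt k l \<le> ?\<gamma> - 1"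
      using le[of k l] kl False by (intro int_poly_discrete) auto
    then show ?thesis using False by (auto simp: scalar_le_def le_diff_eq)
  qed (use i in \<open>auto simp: scalar_le_0\<close>)
  moreover have "u - free_scalar (c i j) * (gx ^ i * gy ^ j) - basis_sum ?d \<in> sI"
    using u i by (simp add: basis_sum_add basis_sum_delta free_scalar_simps)
  ultimately have "u - free_scalar (c i j) * (gx ^ i * gy ^ j) \<in> Fil (?\<gamma> - 1)"
    unfolding Fil_def by blast
  then show ?thesis
    using i by (auto simp: Lead_def scalar_le_def)
qed

text \<open>
  The trace of an element is minus its coordinate at \<open>x\<^sup>p\<^sup>-\<^sup>1\<close>, which bounds its degree.
\<close>

lemma algtr_Fil:
  assumes "u \<in> Fil \<gamma>"
  shows "\<exists>f. algtr u = to_ac f \<and> scalar_le f (\<gamma> - of_nat (p - 1))"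
proof -
  from assms obtain c where c: "u - basis_sum c \<in> sI" "\<forall>i<p. \<forall>j<p. scalar_le (c i j) (\<gamma> - wt i j)"
    by (auto simp: Fil_def)
  have mon: "algtr (gx ^ i * gy ^ j) = (if i = p - 1 \<and> j = 0 then - 1 else 0)" if "i < p" "j < p" for i j
  proof (cases "j = 0")
    case True
    then show ?thesis using algtr_monomial(2)[of i] algtr_monomial(3) that by (cases "i = p - 1") auto
  next
    case False
    then have "\<not> p dvd j" using that by (auto dest: dvd_imp_le)
    then show ?thesis using algtr_monomial(1)[of j i] False by simp
  qed
  have "algtr u = (\<Sum>i<p. \<Sum>j<p. to_ac (c i j) * algtr (gx ^ i * gy ^ j))"
    using algtr_cong[OF c(1)] by (simp add: basis_sum_def algtr.tr_sum algtr_scalar)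
  also have "\<dots> = (\<Sum>i<p. if i = p - 1 then - to_ac (c i 0) else 0)"
  proof (rule sum.cong)
    fix i assume i: "i \<in> {..<p}"
    have "(\<Sum>j<p. to_ac (c i j) * algtr (gx ^ i * gy ^ j)) =
        (\<Sum>j<p. if j = 0 then if i = p - 1 then - to_ac (c i j) else 0 else 0)"
      by (rule sum.cong) (use i in \<open>simp_all add: mon\<close>)
    then show "(\<Sum>j<p. to_ac (c i j) * algtr (gx ^ i * gy ^ j)) =
        (if i = p - 1 then - to_ac (c i 0) else 0)"
      using p2 by simp
  qed simp
  also have "\<dots> = - to_ac (c (p - 1) 0)"
    using p2 by simp
  also have "\<dots> = to_ac (- 1 * c (p - 1) 0)"
    by simp
  finally have "algtr u = to_ac (- 1 * c (p - 1) 0)" .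
  moreover have "scalar_le (c (p - 1) 0) (\<gamma> - wt (p - 1) 0)"
    using c(2) p2 by simp
  then have "scalar_le (- 1 * c (p - 1) 0) (0 + (\<gamma> - of_nat (p - 1)))"
    by (intro scalar_le_mult scalar_le_minus_1) (simp add: wt_def)
  ultimately show ?thesis by (simp only: add_0) blast
qed

text \<open>
  Modulo smaller degree, \<open>x\<^sup>p\<close> may be replaced by \<open>a\<close>, since \<open>x\<^sup>p = x + a\<close> and \<open>x\<close> has degree \<open>1 < p\<close>, and
  \<open>y\<^sup>p\<close> by \<open>b\<close>.
\<close>

lemma Lead_reduce:
  "gx ^ (q * p + i) * gy ^ (r * p) - free_scalar (a ^ q * b ^ r) * gx ^ i
    \<in> Fil (wt (q * p + i) (r * p) - 1)"
proof (induction r)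
  case 0
  show ?case
  proof (induction q)
    case (Suc q)
    have "free_scalar a * (gx ^ (q * p + i) - free_scalar (a ^ q) * gx ^ i) \<in>
        Fil (of_nat p + (wt (q * p + i) 0 - 1))"
      using Suc by (intro Fil_scalar scalar_le_a) simp
    moreover have "gx ^ Suc (q * p + i) \<in> Fil (wt (Suc (q * p + i)) 0)"
      using Fil_monomial[of "Suc (q * p + i)" 0] by simp
    then have "gx ^ Suc (q * p + i) \<in> Fil (of_nat p + (wt (q * p + i) 0 - 1))"
      by (rule Fil_mono) (use p2 in \<open>simp add: wt_Suc\<close>)
    ultimately have "free_scalar a * (gx ^ (q * p + i) - free_scalar (a ^ q) * gx ^ i) +
        gx ^ Suc (q * p + i) \<in> Fil (of_nat p + (wt (q * p + i) 0 - 1))"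
      by (rule Fil_add)
    moreover have "gx ^ (p + (q * p + i)) - (gx ^ Suc (q * p + i) + free_scalar a * gx ^ (q * p + i)) \<in> sI"
      using reduce_x[of "q * p + i" 0] by simp
    ultimately have "gx ^ (p + (q * p + i)) - (gx ^ Suc (q * p + i) + free_scalar a * gx ^ (q * p + i)) +
       (free_scalar a * (gx ^ (q * p + i) - free_scalar (a ^ q) * gx ^ i) +
        gx ^ Suc (q * p + i)) \<in> Fil (of_nat p + (wt (q * p + i) 0 - 1))"
      by - (rule Fil_add[OF Fil_ideal])
    then have "gx ^ (p + (q * p + i)) - free_scalar (a ^ Suc q) * gx ^ i
        \<in> Fil (of_nat p + (wt (q * p + i) 0 - 1))"
      by (simp add: right_diff_distrib free_scalar_simps mult.assoc)
    moreover have "of_nat p + (wt (q * p + i) 0 - 1) = wt (p + (q * p + i)) 0 - 1"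
      by (simp add: wt_def)
    ultimately show ?case by (simp add: add.assoc)
  qed (simp add: free_scalar_simps Fil_0)
next
  case (Suc r)
  let ?i = "q * p + i"
  have "free_scalar b * (gx ^ ?i * gy ^ (r * p) - free_scalar (a ^ q * b ^ r) * gx ^ i)
      \<in> Fil (of_nat p * omega + (wt ?i (r * p) - 1))"
    by (intro Fil_scalar scalar_le_b Suc)
  from Fil_add[OF Fil_ideal[OF reduce_y[of ?i "r * p"]] this]
  have "gx ^ ?i * gy ^ (p + r * p) - free_scalar (a ^ q * b ^ Suc r) * gx ^ i
      \<in> Fil (of_nat p * omega + (wt ?i (r * p) - 1))"
    by (simp add: right_diff_distrib free_scalar_simps mult.assoc[symmetric])
       (simp add: mult.commute flip: free_scalar_simps)
  then show ?case by (simp add: wt_p add_ac add_diff_eq)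
qed

text \<open>
  A nonzero leading term whose exponents are congruent to \<open>(p - 1, 0)\<close> reduces to a nonzero multiple of
  \<open>x\<^sup>p\<^sup>-\<^sup>1\<close>, and the terms of smaller degree cannot cancel its trace.
\<close>

lemma algtr_Lead_nonzero:
  assumes L: "Lead (of_nat p * \<delta> e + wt I J) I J e u" and e: "e \<noteq> 0"
    and I: "[I = p - 1] (mod p)" and J: "p dvd J"
  shows "algtr u \<noteq> 0"
proof
  assume tr: "algtr u = 0"
  let ?\<gamma> = "of_nat p * \<delta> e + wt I J"
  have "I mod p = p - 1" using I p2 by (simp add: cong_def)
  \<comment> \<open>the exponents of \<open>a\<close> and \<open>b\<close> that the reduction produces\<close>
  then obtain q where q: "I = q * p + (p - 1)" by (metis div_mult_mod_eq)
  obtain r where r: "J = r * p" using J by (metis dvdE mult.commute)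
  let ?f = "e * (a ^ q * b ^ r)"
  have "free_scalar e * (gx ^ I * gy ^ J - free_scalar (a ^ q * b ^ r) * gx ^ (p - 1)) \<in> Fil (of_nat p * \<delta> e + (wt I J - 1))"
    unfolding q r by (intro Fil_scalar Lead_reduce) (simp add: scalar_le_def)
  moreover have "u - free_scalar e * (gx ^ I * gy ^ J) \<in> Fil (?\<gamma> - 1)"
    using L by (simp add: Lead_def)
  ultimately have "u - free_scalar e * (gx ^ I * gy ^ J) +
      free_scalar e * (gx ^ I * gy ^ J - free_scalar (a ^ q * b ^ r) * gx ^ (p - 1)) \<in> Fil (?\<gamma> - 1)"
    by (intro Fil_add) (simp_all add: add_diff_eq)
  then have "u - free_scalar ?f * gx ^ (p - 1) \<in> Fil (?\<gamma> - 1)"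
    by (simp add: right_diff_distrib free_scalar_simps mult.assoc)
  then obtain g where g: "algtr (u - free_scalar ?f * gx ^ (p - 1)) = to_ac g" "scalar_le g (?\<gamma> - 1 - of_nat (p - 1))"
    using algtr_Fil by blast
  have "to_ac g = to_ac ?f"
    using g(1) tr by (simp add: algtr.tr_diff algtr_scalar algtr_monomial(3) del: One_nat_def)
  then have gf: "g = ?f" by (simp only: to_ac_eq_iff)
  have nz: "?f \<noteq> 0" using e a b by simp
  \<comment> \<open>the trace \<open>?f\<close> of the remainder has the degree of the leading term, which is too large\<close>
  have "\<delta> ?f = \<delta> e + (of_nat q + of_nat r * omega)"
    using e a b by (simp only: delta_mult delta_power delta_a delta_b mult_eq_0_iff power_eq_0_iff simp_thms)
  then have "of_nat p * \<delta> ?f = ?\<gamma> - of_nat (p - 1)"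
    unfolding q r wt_def by (simp add: algebra_simps)
  moreover have "of_nat p * \<delta> ?f \<le> ?\<gamma> - 1 - of_nat (p - 1)"
    using g(2) nz unfolding gf scalar_le_def by blast
  ultimately show False by simp
qed

end

section \<open>Exponent pairs and linear systems\<close>

text \<open>
  For parallel vectors \<open>(x, x')\<close> and \<open>(y, y')\<close> that differ in the first component modulo \<open>p\<close>, the
  combination with coefficients \<open>- 1 - d\<close> and \<open>d\<close> vanishes for a suitable \<open>d\<close>.
\<close>

lemma parallel_vanishing_combination:
  fixes x y x' y' p :: int
  assumes p: "prime p" and xy: "\<not> p dvd y - x" and cross: "p dvd x * y' - x' * y"
  shows "\<exists>d\<in>{0..<p}. p dvd d * (y - x) - x \<and> p dvd d * (y' - x') - x'"
proof -
  have cop: "coprime (y - x) p"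
    using p xy by (simp add: coprime_commute prime_imp_coprime)
  then obtain z where z: "[(y - x) * z = 1] (mod p)"
    using cong_solve_coprime_int by blast
  define d where "d = (x * z) mod p"
  have "[d * (y - x) = x * z * (y - x)] (mod p)"
    unfolding d_def by (intro cong_mult cong_refl) (simp add: cong_def)
  also have "x * z * (y - x) = x * ((y - x) * z)"
    by (simp add: mult_ac)
  also have "[x * ((y - x) * z) = x * 1] (mod p)"
    by (intro cong_mult z cong_refl)
  finally have 1: "p dvd d * (y - x) - x"
    by (simp add: cong_iff_dvd_diff)
  have "(y - x) * (d * (y' - x') - x') = (d * (y - x) - x) * (y' - x') + (x * y' - x' * y)"
    by (simp add: algebra_simps)
  then have "p dvd (y - x) * (d * (y' - x') - x')"
    using 1 cross by simp
  then have "p dvd d * (y' - x') - x'"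
    using cop by (simp add: coprime_commute coprime_dvd_mult_right_iff)
  moreover have "d \<in> {0..<p}"
    using prime_gt_0_int[OF p] by (simp add: d_def)
  ultimately show ?thesis using 1 by blast
qed

text \<open>
  Translating by \<open>(-1, 0)\<close>, where \<open>r + m = p - 1\<close>, turns the target \<open>(p - 1, 0)\<close> into \<open>(0, 0)\<close>. The
  function \<open>f\<close> in the proof assigns to a translated point its slope in \<open>{0..<p}\<close>, or \<open>p\<close> if the first
  component is zero; the zero vector, being parallel to everything, may get any value.
\<close>

lemma weighted_pair_exists:
  fixes p :: nat and S :: "(nat \<times> nat) set"
  assumes p: "prime p" and S: "S \<subseteq> {..<p} \<times> {..<p}" and card: "card S \<ge> p + 2"
  shows "\<exists>i j k l r m. (i, j) \<in> S \<and> (k, l) \<in> S \<and> r + m = p - 1 \<and>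
    [r * i + m * k = p - 1] (mod p) \<and> p dvd r * j + m * l"
proof -
  let ?P = "int p"
  have pp: "prime ?P" using p by simp
  have "\<exists>t\<le>p. (t = p \<and> ?P dvd int i - 1) \<or> (t < p \<and> ?P dvd int t * (int i - 1) - int j)" for i j
  proof (cases "?P dvd int i - 1")
    case False
    then have "coprime (int i - 1) ?P"
      using pp by (simp add: coprime_commute prime_imp_coprime)
    then obtain z where z: "[(int i - 1) * z = 1] (mod ?P)"
      using cong_solve_coprime_int by blast
    define t where "t = nat ((int j * z) mod ?P)"
    have t: "int t = (int j * z) mod ?P" "t < p"
      using prime_gt_0_nat[OF p] by (simp_all add: t_def nat_less_iff)
    have "[int t * (int i - 1) = int j * z * (int i - 1)] (mod ?P)"
      unfolding t by (intro cong_mult cong_refl) (simp add: cong_def)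
    also have "int j * z * (int i - 1) = int j * ((int i - 1) * z)"
      by (simp add: mult_ac)
    also have "[int j * ((int i - 1) * z) = int j * 1] (mod ?P)"
      by (intro cong_mult z cong_refl)
    finally show ?thesis
      using t(2) by (auto simp: cong_iff_dvd_diff intro!: exI[of _ t])
  qed auto
  then obtain f where f: "\<And>i j. f (i, j) \<le> p"
    "\<And>i j. (f (i, j) = p \<and> ?P dvd int i - 1) \<or> (f (i, j) < p \<and> ?P dvd int (f (i, j)) * (int i - 1) - int j)"
    by (metis (no_types, lifting) case_prod_conv)
  have "f ` S \<subseteq> {..p}" using f(1) by auto
  then have "card (f ` S) \<le> p + 1"
    using card_mono[of "{..p}" "f ` S"] by simp
  then have "\<not> inj_on f S"
    using card by (intro pigeonhole) simp
  then obtain i j k l where ijkl: "(i, j) \<in> S" "(k, l) \<in> S" "(i, j) \<noteq> (k, l)" "f (i, j) = f (k, l)"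
    by (auto simp: inj_on_def)
  let ?x = "int i - 1" and ?y = "int k - 1"
  have cross: "?P dvd ?x * int l - int j * ?y"
  proof (cases "f (i, j) = p")
    case True
    then have "?P dvd ?x" "?P dvd ?y" using f(2)[of i j] f(2)[of k l] ijkl(4) by auto
    then show ?thesis by simp
  next
    case False
    let ?t = "int (f (i, j))"
    have "?P dvd ?t * ?x - int j" "?P dvd ?t * ?y - int l"
      using False f(2)[of i j] f(2)[of k l] ijkl(4) by auto
    then have "?P dvd (?t * ?x - int j) * ?y - (?t * ?y - int l) * ?x"
      by (rule dvd_diff[OF dvd_mult2 dvd_mult2])
    then show ?thesis by (simp add: algebra_simps)
  qed
  have lt: "i < p" "j < p" "k < p" "l < p" using ijkl S by auto
  have eq: "x = y" if "?P dvd int y - int x" "x < p" "y < p" for x y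
    using that by (metis cong_iff_dvd_diff cong_int_iff cong_less_modulus_unique_nat cong_sym)
  have "\<exists>d\<in>{0..<?P}. ?P dvd d * (?y - ?x) - ?x \<and> ?P dvd d * (int l - int j) - int j"
  proof (cases "i = k")
    case False
    then have "\<not> ?P dvd ?y - ?x" using eq[of k i] lt by auto
    from parallel_vanishing_combination[OF pp this cross] show ?thesis .
  next
    case True
    then have "\<not> ?P dvd int l - int j" using eq[of l j] lt ijkl(3) by auto
    moreover have "?P dvd int j * ?y - ?x * int l"
      using cross by (metis dvd_diff_commute)
    ultimately show ?thesis
      using parallel_vanishing_combination[OF pp, of "int l" "int j" ?y ?x] by blast
  qed
  then obtain d where d: "0 \<le> d" "d < ?P" "?P dvd d * (?y - ?x) - ?x" "?P dvd d * (int l - int j) - int j"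
    by auto
  obtain m where m: "d = int m" using d(1) by (metis nonneg_int_cases)
  define r where "r = p - 1 - m"
  have rm: "r + m = p - 1" using d(2) m by (simp add: r_def)
  have r: "int r = ?P - 1 - int m" using d(2) m by (simp add: r_def)
  have "int (r * i + m * k) - int (p - 1) = ?P * ?x + (d * (?y - ?x) - ?x)"
    using prime_gt_0_nat[OF p] by (simp add: r m algebra_simps)
  moreover have "?P dvd \<dots>" using d(3) by simp
  ultimately have "[r * i + m * k = p - 1] (mod p)"
    by (metis cong_iff_dvd_diff cong_int_iff)
  moreover have "int (r * j + m * l) = ?P * int j + (d * (int l - int j) - int j)"
    by (simp add: r m algebra_simps)
  moreover have "?P dvd \<dots>" using d(4) by simp
  ultimately have "[r * i + m * k = p - 1] (mod p)" "p dvd r * j + m * l"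
    by (simp_all only: flip: int_dvd_int_iff)
  then show ?thesis using ijkl(1,2) rm by blast
qed

text \<open>
  A homogeneous linear system with more unknowns than equations has a nonzero solution.
\<close>

lemma underdetermined_system:
  fixes c :: "'k \<Rightarrow> 's \<Rightarrow> 'f::field"
  assumes "finite S" "finite T" "card S < card T"
  shows "\<exists>g. (\<exists>k\<in>T. g k \<noteq> 0) \<and> (\<forall>s\<in>S. (\<Sum>k\<in>T. g k * c k s) = 0)"
  using assms
proof (induction S arbitrary: T c rule: finite_induct)
  case empty
  then have "T \<noteq> {}" by auto
  then show ?case by (intro exI[of _ "\<lambda>_. 1"]) auto
next
  case (insert s S)
  show ?case
  proof (cases "\<forall>k\<in>T. c k s = 0")
    case True
    have "card S < card T" using insert by simp
    from insert.IH[OF insert.prems(1) this, of c] obtain g where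
      "\<exists>k\<in>T. g k \<noteq> 0" "\<forall>s\<in>S. (\<Sum>k\<in>T. g k * c k s) = 0" by auto
    then show ?thesis using True by (intro exI[of _ g]) auto
  next
    case False
    then obtain k0 where k0: "k0 \<in> T" "c k0 s \<noteq> 0" by blast
    \<comment> \<open>eliminate the unknown \<open>k0\<close> by means of equation \<open>s\<close>\<close>
    let ?c = "\<lambda>k t. c k t - c k s / c k0 s * c k0 t"
    have "card S < card (T - {k0})" using insert k0 by simp
    from insert.IH[OF _ this, of ?c] insert.prems obtain g where
      g: "\<exists>k\<in>T - {k0}. g k \<noteq> 0" "\<forall>t\<in>S. (\<Sum>k\<in>T - {k0}. g k * ?c k t) = 0" by auto
    define \<mu> where "\<mu> = g(k0 := - (\<Sum>k\<in>T - {k0}. g k * (c k s / c k0 s)))"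
    have sum: "(\<Sum>k\<in>T. \<mu> k * c k t) = (\<Sum>k\<in>T - {k0}. g k * ?c k t)" for t
    proof -
      have "(\<Sum>k\<in>T. \<mu> k * c k t) = \<mu> k0 * c k0 t + (\<Sum>k\<in>T - {k0}. \<mu> k * c k t)"
        using insert.prems k0 by (simp add: sum.remove)
      also have "(\<Sum>k\<in>T - {k0}. \<mu> k * c k t) = (\<Sum>k\<in>T - {k0}. g k * c k t)"
        by (rule sum.cong) (auto simp: \<mu>_def)
      finally show ?thesis
        by (simp add: \<mu>_def right_diff_distrib sum_subtractf sum_distrib_right mult.assoc)
    qed
    have "\<exists>k\<in>T. \<mu> k \<noteq> 0" using g(1) by (auto simp: \<mu>_def)
    moreover have "\<forall>t\<in>insert s S. (\<Sum>k\<in>T. \<mu> k * c k t) = 0"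
      using g(2) k0 by (simp add: sum)
    ultimately show ?thesis by blast
  qed
qed

section \<open>The upper bound\<close>

context graded_setting
begin

lemma infinite_field: "infinite (UNIV :: 'f set)"
proof -
  have "inj (\<lambda>n. a ^ n)"
  proof (rule injI)
    fix m n assume "a ^ m = a ^ n"
    then have "\<delta> (a ^ m) = \<delta> (a ^ n)" by simp
    then show "m = n" using a by (simp add: delta_power delta_a)
  qed
  then show ?thesis by (metis finite_imageD finite_subset infinite_UNIV_nat subset_UNIV)
qed

text \<open>
  A nonzero element of the prime field and its inverse both have degree at most zero.
\<close>

lemma delta_of_nat:
  assumes "of_nat n \<noteq> (0::'f)"
  shows "\<delta> (of_nat n) = 0"
proof -
  have "\<not> p dvd n" using assms char_p by (simp add: of_nat_eq_0_iff_char_dvd)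
  then have "coprime n p" using p by (metis coprime_commute prime_imp_coprime)
  then obtain m where "[n * m = 1] (mod p)" using cong_solve_coprime_nat by auto
  then have nm: "of_nat n * of_nat m = (1::'f)"
    using char_p by (metis of_nat_1 of_nat_eq_iff_cong_CHAR of_nat_mult)
  then have m: "of_nat m \<noteq> (0::'f)" by auto
  have le: "\<delta> (of_nat k) \<le> 0" if "of_nat k \<noteq> (0::'f)" for k
    using scalar_le_of_nat[of k] that p2 by (simp add: scalar_le_def mult_le_0_iff)
  have "\<delta> (of_nat n) + \<delta> (of_nat m) = 0"
    using delta_mult[OF assms m] nm delta_1 by simp
  then show ?thesis using le[OF assms] le[OF m] by simp
qed

lemma binomial_pred_nonzero:
  assumes "m \<le> p - 1"
  shows "of_nat ((p - 1) choose m) \<noteq> (0::'f)"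
proof -
  have "\<not> p dvd fact (p - 1)"
    using p p2 by (simp add: prime_dvd_fact_iff)
  then have "\<not> p dvd ((p - 1) choose m)"
    using binomial_fact_lemma[OF assms] by (metis dvd_mult)
  then show ?thesis using char_p by (simp add: of_nat_eq_0_iff_char_dvd)
qed

text \<open>
  If all \<open>u + t v\<close> are \<open>p\<close>-central, the trace of \<open>(u + t v)\<^sup>p\<^sup>-\<^sup>1\<close> vanishes for every scalar \<open>t\<close>. It is a
  polynomial in \<open>t\<close> with the traces of the mixed terms as coefficients, and the field is infinite.
\<close>

lemma algtr_mixed_sum:
  assumes "\<And>t. \<exists>c. (u + free_scalar t * v) ^ p - free_scalar c \<in> sI" and m: "m \<le> p - 1"
  shows "algtr (mixed_sum u v (p - 1) m) = 0"
proof -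
  define q where "q = (\<Sum>m\<le>p - 1. monom (algtr (mixed_sum u v (p - 1) m)) m)"
  have "poly q (to_ac t) = 0" for t
  proof -
    have "algtr ((u + free_scalar t * v) ^ (p - 1)) = 0"
      using assms(1) algtr_power_pred by blast
    moreover have "(u + free_scalar t * v) ^ (p - 1) =
        (\<Sum>m\<le>p - 1. free_scalar (t ^ m) * mixed_sum u v (p - 1) m)"
      unfolding free_scalar_simps by (rule power_add_central) (rule free_scalar_commute)
    ultimately have "(\<Sum>m\<le>p - 1. to_ac t ^ m * algtr (mixed_sum u v (p - 1) m)) = 0"
      by (simp add: algtr.tr_sum algtr_scalar)
    then show ?thesis
      by (simp add: q_def poly_sum poly_monom mult.commute)
  qed
  then have "range to_ac \<subseteq> {x. poly q x = 0}" by auto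
  moreover have "infinite (range (to_ac :: 'f \<Rightarrow> _))"
    using infinite_field inj_to_ac finite_imageD by blast
  ultimately have "q = 0"
    using poly_roots_finite finite_subset by blast
  moreover have "coeff q m = algtr (mixed_sum u v (p - 1) m)"
    using m by (simp add: q_def coeff_sum sum.delta)
  ultimately show ?thesis by simp
qed

text \<open>
  The properties of the preimage in the free algebra of a \<open>p\<close>-central subspace that the bound needs.
\<close>

definition p_central_lift :: "'f free_alg set \<Rightarrow> bool"
  where "p_central_lift W \<longleftrightarrow> 0 \<in> W \<and> (\<forall>u\<in>W. \<forall>v\<in>W. u + v \<in> W) \<and>
    (\<forall>c. \<forall>u\<in>W. free_scalar c * u \<in> W) \<and> (\<forall>u\<in>W. \<exists>c. u ^ p - free_scalar c \<in> sI)"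

text \<open>
  The exponents of the leading monomials of the nonzero elements of \<open>W\<close>.
\<close>

definition lead_positions :: "'f free_alg set \<Rightarrow> (nat \<times> nat) set"
  where "lead_positions W = {(i, j). i < p \<and> j < p \<and>
    (\<exists>u\<in>W. \<exists>e. e \<noteq> 0 \<and> Lead (of_nat p * \<delta> e + wt i j) i j e u)}"

text \<open>
  Otherwise two elements \<open>u\<close>, \<open>v\<close> of \<open>W\<close> have leading exponents as in \<open>weighted_pair_exists\<close>, and their
  mixed term of bidegree \<open>(r, m)\<close> would have nonzero trace.
\<close>

lemma card_lead_positions:
  assumes W: "p_central_lift W"
  shows "finite (lead_positions W)" "card (lead_positions W) \<le> p + 1"
proof -
  have sub: "lead_positions W \<subseteq> {..<p} \<times> {..<p}"
    by (auto simp: lead_positions_def)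
  then show "finite (lead_positions W)" by (rule finite_subset) simp
  show "card (lead_positions W) \<le> p + 1"
  proof (rule ccontr)
    assume "\<not> ?thesis"
    then obtain i j k l r m where *: "(i, j) \<in> lead_positions W" "(k, l) \<in> lead_positions W"
      "r + m = p - 1" "[r * i + m * k = p - 1] (mod p)" "p dvd r * j + m * l"
      using weighted_pair_exists[OF p sub] by auto
    from *(1,2) obtain u v e f where u: "u \<in> W" "e \<noteq> 0" "Lead (of_nat p * \<delta> e + wt i j) i j e u"
      and v: "v \<in> W" "f \<noteq> 0" "Lead (of_nat p * \<delta> f + wt k l) k l f v"
      by (auto simp: lead_positions_def)
    let ?e = "of_nat ((p - 1) choose m) * (e ^ r * f ^ m)"
    have b: "of_nat ((p - 1) choose m) \<noteq> (0::'f)"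
      using *(3) by (intro binomial_pred_nonzero) simp
    have "\<delta> ?e = of_nat r * \<delta> e + of_nat m * \<delta> f"
      using b u(2) v(2) by (simp add: delta_mult delta_power delta_of_nat)
    then have deg: "of_nat r * (of_nat p * \<delta> e + wt i j) + of_nat m * (of_nat p * \<delta> f + wt k l) =
        of_nat p * \<delta> ?e + wt (r * i + m * k) (r * j + m * l)"
      unfolding wt_add wt_mult by (simp only: distrib_left mult.left_commute[of "of_nat p"] add_ac)
    have "Lead (of_nat p * \<delta> ?e + wt (r * i + m * k) (r * j + m * l)) (r * i + m * k) (r * j + m * l)
        ?e (mixed_sum u v (p - 1) m)"
      using Lead_mixed_sum[OF u(3) v(3), of r m] unfolding deg *(3) .
    then have "algtr (mixed_sum u v (p - 1) m) \<noteq> 0"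
      by (rule algtr_Lead_nonzero) (use b u(2) v(2) * in auto)
    moreover have "algtr (mixed_sum u v (p - 1) m) = 0"
      by (rule algtr_mixed_sum) (use W u(1) v(1) *(3) in \<open>auto simp: p_central_lift_def\<close>)
    ultimately show False by simp
  qed
qed

lemma p_central_lift_sum:
  assumes W: "p_central_lift W" and "\<And>k. k \<in> T \<Longrightarrow> f k \<in> W"
  shows "sum f T \<in> W"
  using assms(2) by (induction T rule: infinite_finite_induct) (use W in \<open>auto simp: p_central_lift_def\<close>)

text \<open>
  More than \<open>p + 1\<close> elements have a nontrivial combination whose coordinates vanish at all leading
  exponents of \<open>W\<close>. As the combination lies in \<open>W\<close>, it has no leading term and is zero modulo the
  ideal.
\<close>

lemma p_central_lift_dependent:
  assumes W: "p_central_lift W" and T: "finite T" "card T > p + 1" and u: "\<And>k. k \<in> T \<Longrightarrow> u k \<in> W"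
  shows "\<exists>g. (\<exists>k\<in>T. g k \<noteq> 0) \<and> (\<Sum>k\<in>T. free_scalar (g k) * u k) \<in> sI"
proof -
  have "\<forall>k. \<exists>c. u k - basis_sum c \<in> sI"
    using basis_sum_exists by blast
  from choice[OF this] obtain c where c: "\<And>k. u k - basis_sum (c k) \<in> sI"
    by blast
  have "card (lead_positions W) < card T"
    using card_lead_positions[OF W] T(2) by simp
  from underdetermined_system[OF card_lead_positions(1)[OF W] T(1) this, of "\<lambda>k s. c k (fst s) (snd s)"]
  obtain g where g: "\<exists>k\<in>T. g k \<noteq> 0"
    "\<And>i j. (i, j) \<in> lead_positions W \<Longrightarrow> (\<Sum>k\<in>T. g k * c k i j) = 0" by fastforce
  define d where "d = (\<lambda>i j. \<Sum>k\<in>T. g k * c k i j)"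
  let ?v = "\<Sum>k\<in>T. free_scalar (g k) * u k"
  have vW: "?v \<in> W"
    by (rule p_central_lift_sum[OF W]) (use W u in \<open>auto simp: p_central_lift_def\<close>)
  have bs: "basis_sum d = (\<Sum>k\<in>T. free_scalar (g k) * basis_sum (c k))"
    unfolding d_def using T(1)
    by (induction T rule: finite_induct) (simp_all add: basis_sum_def free_scalar_simps distrib_right
        sum.distrib sum_distrib_left mult.assoc)
  have "?v - basis_sum d = (\<Sum>k\<in>T. free_scalar (g k) * (u k - basis_sum (c k)))"
    by (simp add: bs right_diff_distrib sum_subtractf)
  also have "\<dots> \<in> sI"
    by (intro ideal_sum ideal_mult_left c)
  finally have v: "?v - basis_sum d \<in> sI" .
  have "d i j = 0" if ij: "i < p" "j < p" for i j
  proof (rule ccontr)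
    assume "d i j \<noteq> 0"
    then obtain k l where kl: "k < p" "l < p" "d k l \<noteq> 0" "Lead (of_nat p * \<delta> (d k l) + wt k l) k l (d k l) ?v"
      using Lead_exists[OF v] ij by blast
    then have "(k, l) \<in> lead_positions W"
      using vW by (auto simp: lead_positions_def)
    then show False using g(2) kl(3) by (simp add: d_def)
  qed
  then have "basis_sum d = 0"
    by (simp add: basis_sum_def free_scalar_simps)
  then show ?thesis using v g(1) by auto
qed

end

section \<open>Norms and the lower bound\<close>

lemma pcompose_power: "pcompose (h ^ n) q = pcompose h q ^ n"
  by (induction n) (simp_all add: pcompose_mult pcompose_1)

context symbol_setting
begin

lemma power_p_add_scalar:
  fixes c :: 'f
  shows "(u + free_scalar c) ^ p = u ^ p + free_scalar (c ^ p)"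
proof -
  have "(u + free_scalar c * 1) ^ p = (\<Sum>m\<le>p. free_scalar c ^ m * mixed_sum u 1 p m)"
    by (rule power_add_central) (rule free_scalar_commute)
  also have "\<dots> = (\<Sum>m\<in>{0, p}. free_scalar c ^ m * mixed_sum u 1 p m)"
  proof (rule sum.mono_neutral_right)
    have "free_scalar c ^ m * mixed_sum u 1 p m = 0" if "m \<in> {..p} - {0, p}" for m
    proof -
      have "p dvd (p choose m)"
        using that p by (intro dvd_choose_prime) auto
      then show ?thesis by (simp add: mixed_sum_1 of_nat_char)
    qed
    then show "\<forall>m\<in>{..p} - {0, p}. free_scalar c ^ m * mixed_sum u 1 p m = 0"
      by blast
  qed auto
  also have "\<dots> = u ^ p + free_scalar (c ^ p)"
    using p2 by (simp add: mixed_sum_1 free_scalar_simps)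
  finally show ?thesis by simp
qed

text \<open>
  Evaluation of a polynomial at the generator \<open>x\<close>.
\<close>

definition ev :: "'f poly \<Rightarrow> 'f free_alg"
  where "ev h = (\<Sum>i\<le>degree h. free_scalar (coeff h i) * gx ^ i)"

lemma ev_superset: "degree h \<le> n \<Longrightarrow> ev h = (\<Sum>i\<le>n. free_scalar (coeff h i) * gx ^ i)"
  unfolding ev_def by (rule sum.mono_neutral_left) (auto simp: coeff_eq_0 free_scalar_simps)

lemma ev_pCons: "ev (pCons c h) = free_scalar c + gx * ev h"
proof -
  have "ev (pCons c h) = (\<Sum>i\<le>Suc (degree h). free_scalar (coeff (pCons c h) i) * gx ^ i)"
    by (rule ev_superset) (rule degree_pCons_le)
  also have "\<dots> = free_scalar c + (\<Sum>i\<le>degree h. free_scalar (coeff h i) * gx ^ Suc i)"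
    by (subst sum.atMost_Suc_shift) simp
  also have "(\<Sum>i\<le>degree h. free_scalar (coeff h i) * gx ^ Suc i) = gx * ev h"
    unfolding ev_def sum_distrib_left
    by (simp add: free_scalar_left_commute)
  finally show ?thesis .
qed

lemma ev_0: "ev 0 = 0"
  by (simp add: ev_def free_scalar_simps)

lemma ev_add: "ev (g + h) = ev g + ev h"
  using ev_superset[of g "max (degree g) (degree h)"] ev_superset[of h "max (degree g) (degree h)"]
    ev_superset[of "g + h" "max (degree g) (degree h)"] degree_add_le_max[of g h]
  by (simp add: free_scalar_simps distrib_right sum.distrib)

lemma ev_smult: "ev (smult c h) = free_scalar c * ev h"
  using ev_superset[of "smult c h" "degree h"] degree_smult_le[of c h]
  by (simp add: ev_def free_scalar_simps sum_distrib_left mult.assoc)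

lemma ev_mult: "ev (g * h) = ev g * ev h"
  by (induction g) (simp_all add: ev_0 ev_pCons ev_add ev_smult distrib_right mult.assoc free_scalar_simps)

lemma ev_linear: "ev [:of_nat j, 1:] = gx + of_nat j"
  by (simp add: ev_pCons ev_0 free_scalar_simps) (simp add: free_scalar_def)

lemma gy_power_ev: "gy ^ j * ev h - ev (pcompose h [:of_nat j, 1:]) * gy ^ j \<in> sI"
proof (induction h)
  case 0
  show ?case by (simp add: ev_0 ideal_0)
next
  case (pCons c h)
  let ?h = "pcompose h [:of_nat j, 1:]"
  have ev: "ev (pcompose (pCons c h) [:of_nat j, 1:]) = free_scalar c + (gx + of_nat j) * ev ?h"
    by (simp only: pcompose_pCons ev_add ev_mult ev_linear) (simp add: ev_pCons ev_0)
  have "gy ^ j * ev (pCons c h) - ev (pcompose (pCons c h) [:of_nat j, 1:]) * gy ^ j =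
      (gy ^ j * gx - (gx + of_nat j) * gy ^ j) * ev h +
      (gx + of_nat j) * (gy ^ j * ev h - ev ?h * gy ^ j)"
    unfolding ev ev_pCons 
    by (simp add: right_diff_distrib left_diff_distrib distrib_left distrib_right mult.assoc
        free_scalar_commute[of c "gy ^ j"] free_scalar_left_commute)
  then show ?case
    using ideal_add[OF ideal_mult_right[OF gy_power_gx] ideal_mult_left[OF pCons(2)]] by simp
qed

text \<open>
  Moving the factors \<open>y\<close> to the right shifts the argument of \<open>g\<close>, so \<open>(g(x) y)\<^sup>n\<close> becomes
  \<open>g(x) g(x + 1) \<dots> g(x + n - 1) y\<^sup>n\<close>.
\<close>

lemma power_ev_Y:
  "(ev g * gy) ^ n - ev (\<Prod>j<n. pcompose g [:of_nat j, 1:]) * gy ^ n \<in> sI"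
proof (induction n)
  case 0
  have "ev 1 = 1" using ev_linear[of 0] by (simp add: ev_def free_scalar_simps)
  then show ?case by (simp add: ideal_0)
next
  case (Suc n)
  let ?P = "\<Prod>j<n. pcompose g [:of_nat j, 1:]" and ?g = "pcompose g [:of_nat n, 1:]"
  have "(ev g * gy) ^ Suc n - ev (\<Prod>j<Suc n. pcompose g [:of_nat j, 1:]) * gy ^ Suc n =
      ((ev g * gy) ^ n - ev ?P * gy ^ n) * (ev g * gy) + ev ?P * (gy ^ n * ev g - ev ?g * gy ^ n) * gy"
    unfolding power_Suc2 prod.lessThan_Suc ev_mult
    by (simp add: right_diff_distrib left_diff_distrib mult.assoc)
  moreover have "\<dots> \<in> sI"
    by (intro ideal_add ideal_mult_right ideal_mult_left Suc gy_power_ev)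
  ultimately show ?case by simp
qed

text \<open>
  A polynomial invariant under \<open>t \<mapsto> t + 1\<close> is a polynomial in \<open>w = t\<^sup>p - t\<close>. Quotient and remainder of
  its division by \<open>w\<close> are invariant too, as \<open>w\<close> is; the remainder takes the same value at the \<open>p\<close>
  elements of the prime field and has degree less than \<open>p\<close>, so it is constant. The quotient is treated
  by induction on the degree.
\<close>

lemma shift_invariant_poly:
  fixes h :: "'f poly"
  assumes "pcompose h [:1, 1:] = h"
  shows "\<exists>q. h = pcompose q (monom 1 p - [:0, 1:])"
  using assms
proof (induction "degree h" arbitrary: h rule: less_induct)
  case less
  define w :: "'f poly" where "w = monom 1 p - [:0, 1:]"
  have "degree [:0, 1 :: 'f:] < degree (monom (1::'f) p)"
    using p2 by (simp add: degree_monom_eq)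
  then have dw: "degree w = p"
    unfolding w_def by (subst diff_conv_add_uminus, subst degree_add_eq_left) (simp_all add: degree_monom_eq)
  have w0: "w \<noteq> 0" using dw p2 by auto
  have "[:1, 1 :: 'f:] ^ p = 1 + monom 1 p"
  proof -
    have "[:1, 1 :: 'f:] ^ p = (1 + monom 1 1) ^ p"
      by (simp add: monom_altdef one_pCons)
    also have "\<dots> = 1 ^ p + monom 1 1 ^ p"
      by (rule freshmans_dream) (simp_all add: p char_p)
    finally show ?thesis by (simp add: monom_power)
  qed
  then have w: "pcompose w [:1, 1:] = w"
    by (simp add: w_def pcompose_diff monom_altdef pcompose_power pcompose_pCons one_pCons)
  let ?q = "h div w" and ?r = "h mod w"
  have h: "h = ?q * w + ?r" by (rule div_mult_mod_eq[symmetric])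
  have dr: "degree ?r < p"
    using degree_mod_less'[of w h] dw w0 p2 by (cases "?r = 0") auto
  let ?q' = "pcompose ?q [:1, 1:]" and ?r' = "pcompose ?r [:1, 1:]"
  have "pcompose h [:1, 1:] = pcompose (?q * w + ?r) [:1, 1:]" using h by (rule arg_cong)
  then have h': "h = ?q' * w + ?r'"
    unfolding less.prems by (simp only: pcompose_add pcompose_mult w)
  have dr': "degree ?r' < degree w"
    using dr dw by (simp add: degree_pcompose)
  have "h div w = ?q' + ?r' div w" "h mod w = ?r' mod w"
    by (subst h', rule div_mult_self3[OF w0], subst h', rule mod_mult_self3)
  then have qr: "?q' = ?q" "?r' = ?r"
    using dr' by (simp_all add: div_poly_less mod_poly_less)
  have "poly ?r (of_nat n) = poly ?r 0" for n
  proof (induction n)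
    case (Suc n)
    have "poly ?r (of_nat (Suc n)) = poly (pcompose ?r [:1, 1:]) (of_nat n)"
      by (simp add: poly_pcompose)
    then show ?case using qr(2) Suc by simp
  qed simp
  then have "of_nat ` {..<p} \<subseteq> {x. poly (?r - [:poly ?r 0:]) x = 0}"
    by auto
  moreover have "inj_on (of_nat :: nat \<Rightarrow> 'f) {..<p}"
    using char_p by (intro inj_onI) (auto simp: of_nat_eq_iff_cong_CHAR cong_def)
  then have "card (of_nat ` {..<p} :: 'f set) = p"
    by (simp add: card_image)
  ultimately have r: "?r = [:poly ?r 0:]"
  proof (cases "?r - [:poly ?r 0:] = 0")
    case False
    have "p \<le> card {x. poly (?r - [:poly ?r 0:]) x = 0}"
      using card_mono[OF poly_roots_finite[OF False] \<open>of_nat ` {..<p} \<subseteq> _\<close>]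
        \<open>card (of_nat ` {..<p} :: 'f set) = p\<close> by simp
    also have "\<dots> \<le> degree (?r - [:poly ?r 0:])"
      by (rule card_poly_roots_bound) (rule False)
    also have "\<dots> \<le> degree ?r"
      by (rule degree_diff_le) simp_all
    finally show ?thesis using dr by simp
  qed simp
  show ?case
  proof (cases "?q = 0")
    case True
    then have "h = ?r" using h by (metis add_0 mult_zero_left)
    then have "h = pcompose [:poly ?r 0:] w" using r by (metis pcompose_const)
    then show ?thesis unfolding w_def by blast
  next
    case False
    then have "degree (?q * w) = degree ?q + p"
      using w0 by (subst degree_mult_eq) (auto simp: dw)
    moreover have "degree h = degree (?q * w)"
    proof -
      have "degree ?r < degree (?q * w)" using dr calculation by simp
      then show ?thesis by (metis h degree_add_eq_left)
    qed
    ultimately have "degree ?q < degree h" using p2 by simp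
    from less.hyps[OF this qr(1)] obtain s where s: "?q = pcompose s w"
      unfolding w_def by blast
    have "pcompose (pCons (poly ?r 0) s) w = [:poly ?r 0:] + w * ?q"
      by (simp only: pcompose_pCons s[symmetric])
    also have "\<dots> = h" using h r by (metis add.commute mult.commute)
    finally show ?thesis unfolding w_def by metis
  qed
qed

text \<open>
  The norm of \<open>g(x)\<close>, the product of its \<open>p\<close> shifts, is a polynomial in \<open>x\<^sup>p - x\<close>, that is, a scalar.
\<close>

lemma power_p_ev_Y: "\<exists>c. (ev g * gy) ^ p - free_scalar c \<in> sI"
proof -
  let ?f = "\<lambda>j. pcompose g [:of_nat j, 1 :: 'f:]"
  let ?h = "\<Prod>j<p. ?f j"
  have "pcompose ?h [:1, 1:] = (\<Prod>j<p. ?f (1 + j * 1))"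
    by (simp add: pcompose_prod pcompose_pCons add.commute flip: pcompose_assoc)
  also have "\<dots> = ?h"
    by (rule prod_periodic_multiples) (use char_p p2 in auto)
  finally obtain q where q: "?h = pcompose q (monom 1 p - [:0, 1:])"
    using shift_invariant_poly by blast
  have evw: "ev (monom 1 p - [:0, 1:]) - free_scalar a \<in> sI"
  proof -
    have "ev (monom 1 n) = gx ^ n" for n
      by (induction n) (simp_all add: monom_0 monom_Suc ev_pCons ev_0 free_scalar_simps)
    moreover have "ev (monom 1 p - [:0, 1:]) = ev (monom 1 p) + ev (smult (- 1) [:0, 1:])"
      unfolding diff_conv_add_uminus by (simp flip: ev_add)
    ultimately have "ev (monom 1 p - [:0, 1:]) = gx ^ p - gx"
      unfolding ev_smult by (simp add: ev_pCons ev_0 free_scalar_simps)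
    then show ?thesis using ideal_rels(1) by simp
  qed
  have "ev (pcompose q (monom 1 p - [:0, 1:])) - free_scalar (poly q a) \<in> sI" for q
  proof (induction q)
    case (pCons c q)
    let ?w = "monom 1 p - [:0, 1:] :: 'f poly"
    have "ev (pcompose (pCons c q) ?w) - free_scalar (poly (pCons c q) a) =
        (ev ?w - free_scalar a) * ev (pcompose q ?w) + free_scalar a * (ev (pcompose q ?w) - free_scalar (poly q a))"
      by (simp only: pcompose_pCons ev_add ev_mult poly_pCons free_scalar_simps)
         (simp add: ev_pCons ev_0 left_diff_distrib right_diff_distrib)
    then show ?case
      using ideal_add[OF ideal_mult_right[OF evw] ideal_mult_left[OF pCons(2)]] by simp
  qed (simp add: ev_0 free_scalar_simps ideal_0)
  then have 1: "ev ?h - free_scalar (poly q a) \<in> sI"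
    using q by simp
  have "(ev g * gy) ^ p - free_scalar (poly q a * b) =
      ((ev g * gy) ^ p - ev ?h * gy ^ p) + (ev ?h - free_scalar (poly q a)) * gy ^ p
      + free_scalar (poly q a) * (gy ^ p - free_scalar b)"
    by (simp add: left_diff_distrib right_diff_distrib free_scalar_simps)
  moreover have "\<dots> \<in> sI"
    by (intro ideal_add ideal_mult_right[OF 1] ideal_mult_left ideal_rels power_ev_Y)
  ultimately show ?thesis by metis
qed

lemma one_notin_ideal: "1 \<notin> sI"
  using ideal_mult_right[of 1 "gx ^ (p - 1)"] algtr_ideal[of "gx ^ (p - 1)"] algtr_monomial(3) by force

lemma free_scalar_in_ideal: "free_scalar c \<in> sI \<longleftrightarrow> c = 0"
proof
  assume "free_scalar c \<in> sI"
  then have "free_scalar (inverse c) * free_scalar c \<in> sI" by (rule ideal_mult_left)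
  then show "c = 0"
    using one_notin_ideal by (cases "c = 0") (simp_all flip: free_scalar_simps(6) add: free_scalar_simps(2))
qed (simp add: free_scalar_simps ideal_0)

text \<open>
  The coefficients are read off by traces: multiplication by \<open>x\<^sup>p\<^sup>-\<^sup>1\<close> isolates \<open>c\<close>. If \<open>m\<close> is the largest
  index with \<open>f m\<close> nonzero, multiplication by \<open>x\<^sup>p\<^sup>-\<^sup>1\<^sup>-\<^sup>m\<close> from the left and \<open>y\<^sup>p\<^sup>-\<^sup>1\<close> from the right
  leaves \<open>- f m b\<close>.
\<close>

lemma basis_independent:
  assumes "free_scalar c + (\<Sum>i<p. free_scalar (f i) * (gx ^ i * gy)) \<in> sI"
  shows "c = 0" "i < p \<Longrightarrow> f i = 0"
proof -
  let ?u = "free_scalar c + (\<Sum>i<p. free_scalar (f i) * (gx ^ i * gy))"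
  have p0: "p - 1 < p" "\<not> p dvd 1" using p2 by auto
  have Y1: "algtr (gx ^ k * (gx ^ i * gy)) = 0" for k i
    using algtr_monomial(1)[OF p0(2), of "k + i"] by (simp add: power_add mult.assoc)
  have "gx ^ (p - 1) * ?u = free_scalar c * gx ^ (p - 1) + (\<Sum>i<p. free_scalar (f i) * (gx ^ (p - 1) * (gx ^ i * gy)))"
    unfolding distrib_left sum_distrib_left
    by (simp add: free_scalar_left_commute free_scalar_commute[of c])
  then have "algtr (gx ^ (p - 1) * ?u) = - to_ac c"
    by (simp add: algtr_add algtr.tr_sum algtr_scalar Y1 algtr_monomial(3) del: One_nat_def)
  moreover have "algtr (gx ^ (p - 1) * ?u) = 0"
    by (intro algtr_ideal ideal_mult_left assms)
  ultimately show c: "c = 0" by simp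
  show "f i = 0" if i: "i < p"
  proof (rule ccontr)
    assume "f i \<noteq> 0"
    define m where "m = Max {i. i < p \<and> f i \<noteq> 0}"
    have "m \<in> {i. i < p \<and> f i \<noteq> 0}"
      unfolding m_def by (rule Max_in) (use i \<open>f i \<noteq> 0\<close> in auto)
    then have m: "m < p" "f m \<noteq> 0" by auto
    have max: "f k = 0" if "m < k" "k < p" for k
    proof (rule ccontr)
      assume "f k \<noteq> 0"
      then have "k \<le> m" unfolding m_def by (intro Max_ge) (use that in auto)
      then show False using that by simp
    qed
    let ?k = "p - 1 - m"
    have "gx ^ ?k * ?u * gy ^ (p - 1) = (\<Sum>i<p. free_scalar (f i) * (gx ^ (?k + i) * gy ^ p))"
    proof -
      have "gx ^ ?k * (free_scalar (f i) * (gx ^ i * gy)) * gy ^ (p - 1) =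
          free_scalar (f i) * (gx ^ (?k + i) * gy ^ p)" for i
      proof -
        have "gy * gy ^ (p - 1) = gy ^ p" using p2 by (cases p) auto
        then show ?thesis
          by (simp add: power_add mult.assoc free_scalar_left_commute)
      qed
      then show ?thesis
        by (simp add: c free_scalar_simps sum_distrib_left sum_distrib_right)
    qed
    moreover have "gx ^ ?k * ?u * gy ^ (p - 1) \<in> sI"
      by (intro ideal_mult_right ideal_mult_left assms)
    ultimately have "algtr (\<Sum>i<p. free_scalar (f i) * (gx ^ (?k + i) * gy ^ p)) = 0"
      using algtr_ideal by metis
    moreover have "algtr (gx ^ j * gy ^ p) = to_ac b * algtr (gx ^ j)" for j
    proof -
      have "gx ^ j * gy ^ p - free_scalar b * gx ^ j \<in> sI"
        using ideal_mult_left[OF ideal_rels(2), of "gx ^ j"]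
        by (simp add: right_diff_distrib free_scalar_commute)
      then show ?thesis using algtr_cong by (metis algtr_scalar)
    qed
    ultimately have "(\<Sum>i<p. to_ac (f i) * (to_ac b * algtr (gx ^ (?k + i)))) = 0"
      by (simp add: algtr.tr_sum algtr_scalar)
    also have "(\<Sum>i<p. to_ac (f i) * (to_ac b * algtr (gx ^ (?k + i)))) =
        (\<Sum>i\<in>{m}. to_ac (f i) * (to_ac b * algtr (gx ^ (?k + i))))"
    proof (rule sum.mono_neutral_right)
      have "to_ac (f i) * (to_ac b * algtr (gx ^ (?k + i))) = 0" if "i \<in> {..<p} - {m}" for i
      proof (cases "m < i")
        case False
        then have "?k + i < p - 1" using that m by auto
        then show ?thesis by (simp add: algtr_monomial(2))
      qed (use max that in auto)
      then show "\<forall>i\<in>{..<p} - {m}. to_ac (f i) * (to_ac b * algtr (gx ^ (?k + i))) = 0" by blast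
    qed (use m in auto)
    also have "\<dots> = - (to_ac (f m) * to_ac b)"
    proof -
      have "?k + m = p - 1" using m by simp
      then show ?thesis by (simp add: algtr_monomial(3) del: One_nat_def)
    qed
    finally show False using m b by simp
  qed
qed

end

section \<open>Passage to the quotient\<close>

context symbol_setting
begin

text \<open>
  \<open>cl\<close> is the projection from the free algebra onto the symbol algebra \<open>sA\<close>, and \<open>sK\<close> is the copy of the
  base field in \<open>sA\<close>.
\<close>

abbreviation "cl \<equiv> symbol_class p a b"
abbreviation "sA \<equiv> symbol_algebra p a b"
abbreviation "sK \<equiv> symbol_scalars p a b"

sublocale A: ring sA
  by (rule ring_symbol_algebra)

lemma cl_eq_iff: "cl u = cl v \<longleftrightarrow> u - v \<in> sI"
proof -
  interpret R: ring "free_algebra :: 'f free_alg ring" by (rule ring_free_algebra)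
  have "\<ominus>\<^bsub>free_algebra\<^esub> v = - v"
    by (rule R.minus_equality) simp_all
  then have "u \<ominus>\<^bsub>free_algebra\<^esub> v = u - v"
    by (simp add: R.minus_eq)
  then show ?thesis
    unfolding symbol_class_def
    using R.quotient_eq_iff_same_a_r_cos[OF ideal_symbol_ideal, of u v] by simp
qed

lemma cl_closed: "cl u \<in> carrier sA"
  using ring_hom_closed[OF symbol_class_ring_hom] by simp

lemma cl_mult: "cl u \<otimes>\<^bsub>sA\<^esub> cl v = cl (u * v)"
  using ring_hom_mult[OF symbol_class_ring_hom, of u v] by simp

lemma cl_add: "cl u \<oplus>\<^bsub>sA\<^esub> cl v = cl (u + v)"
  using ring_hom_add[OF symbol_class_ring_hom, of u v] by simp

lemma cl_1: "\<one>\<^bsub>sA\<^esub> = cl 1"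
  using ring_hom_one[OF symbol_class_ring_hom, of p a b] by simp

lemma cl_0: "\<zero>\<^bsub>sA\<^esub> = cl 0"
  using cl_add[of 0 0] cl_closed[of 0] by (metis A.add.l_cancel_one' add_0)

lemma cl_uminus: "\<ominus>\<^bsub>sA\<^esub> cl u = cl (- u)"
  by (rule A.minus_equality) (simp_all add: cl_closed cl_add cl_0)

lemma carrier_cl: "carrier sA = range cl"
  by (auto simp: symbol_algebra_def symbol_class_def FactRing_def A_RCOSETS_def')

lemma cl_pow: "cl u [^]\<^bsub>sA\<^esub> n = cl (u ^ n)" for n :: nat
  by (induction n) (simp_all add: cl_1 cl_mult power_Suc2 del: power_Suc)

lemma cl_eq_0: "cl u = \<zero>\<^bsub>sA\<^esub> \<longleftrightarrow> u \<in> sI"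
  by (simp add: cl_0 cl_eq_iff)

lemma subfield_scalars: "subfield sK sA"
proof (rule A.subfieldI)
  have K: "sK = range (\<lambda>c. cl (free_scalar c))"
    by (simp add: symbol_scalars_def)
  have "subring sK sA"
  proof (rule A.subringI)
    show "sK \<subseteq> carrier sA" by (auto simp: K cl_closed)
    show "\<one>\<^bsub>sA\<^esub> \<in> sK" unfolding K cl_1 by (rule range_eqI[of _ _ 1]) (simp add: free_scalar_simps)
  next
    fix h assume "h \<in> sK"
    then obtain c where "h = cl (free_scalar c)" by (auto simp: K)
    then have "\<ominus>\<^bsub>sA\<^esub> h = cl (free_scalar (- c))" by (simp add: cl_uminus free_scalar_simps)
    then show "\<ominus>\<^bsub>sA\<^esub> h \<in> sK" by (simp add: K)
  next
    fix h k assume "h \<in> sK" "k \<in> sK"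
    then obtain c d where "h = cl (free_scalar c)" "k = cl (free_scalar d)" by (auto simp: K)
    then show "h \<otimes>\<^bsub>sA\<^esub> k \<in> sK" "h \<oplus>\<^bsub>sA\<^esub> k \<in> sK"
      unfolding K by (simp_all only: cl_mult cl_add flip: free_scalar_simps(3,6)) blast+
  qed
  then show "subcring sK sA"
    by (rule A.subcringI) (auto simp: K cl_mult mult.commute simp flip: free_scalar_simps(6))
  show "Units (sA\<lparr>carrier := sK\<rparr>) = sK - {\<zero>\<^bsub>sA\<^esub>}"
  proof (intro equalityI subsetI)
    fix k assume "k \<in> Units (sA\<lparr>carrier := sK\<rparr>)"
    then obtain l where k: "k \<in> sK" "l \<in> sK" "k \<otimes>\<^bsub>sA\<^esub> l = \<one>\<^bsub>sA\<^esub>"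
      by (auto simp: Units_def)
    then have l: "l \<in> carrier sA" by (auto simp: K cl_closed)
    have "\<one>\<^bsub>sA\<^esub> \<noteq> \<zero>\<^bsub>sA\<^esub>"
      unfolding cl_1 cl_eq_0 by (rule one_notin_ideal)
    then have "k \<noteq> \<zero>\<^bsub>sA\<^esub>" using k(3) A.l_null[OF l] by metis
    then show "k \<in> sK - {\<zero>\<^bsub>sA\<^esub>}" using k(1) by blast
  next
    fix k assume "k \<in> sK - {\<zero>\<^bsub>sA\<^esub>}"
    then have k: "k \<in> range (\<lambda>c. cl (free_scalar c))" "k \<noteq> cl 0"
      by (simp_all add: K flip: cl_0)
    then obtain c where c: "k = cl (free_scalar c)" by blast
    have "c \<noteq> 0" using k(2) c by (metis free_scalar_simps(1))
    then have inv: "cl (free_scalar (inverse c)) \<otimes>\<^bsub>sA\<^esub> k = \<one>\<^bsub>sA\<^esub>" "k \<otimes>\<^bsub>sA\<^esub> cl (free_scalar (inverse c)) = \<one>\<^bsub>sA\<^esub>"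
      unfolding c cl_mult cl_1 free_scalar_simps(6)[symmetric] by (simp_all add: free_scalar_simps(2))
    have "cl (free_scalar (inverse c)) \<in> sK" "k \<in> sK"
      unfolding K c by blast+
    then show "k \<in> Units (sA\<lparr>carrier := sK\<rparr>)"
      unfolding Units_def using inv by simp blast
  qed
qed

lemma combine_cl:
  "length cs = length us \<Longrightarrow> A.combine (map (\<lambda>c. cl (free_scalar c)) cs) (map cl us) =
    cl (\<Sum>k<length us. free_scalar (cs ! k) * us ! k)"
proof (induction cs us rule: list_induct2)
  case (Cons c cs u us)
  show ?case
    by (simp only: list.map A.combine.simps Cons length_Cons sum.lessThan_Suc_shift)
       (simp add: cl_mult cl_add)
qed (simp add: cl_0)

lemma scalar_listE:
  assumes "set Ks \<subseteq> sK"
  obtains cs where "Ks = map (\<lambda>c. cl (free_scalar c)) cs"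
proof -
  have "\<exists>cs. Ks = map (\<lambda>c. cl (free_scalar c)) cs"
    unfolding ex_map_conv using assms by (auto simp: symbol_scalars_def)
  then show ?thesis using that by blast
qed

text \<open>
  A maximal independent family in a subspace spans it.
\<close>

lemma subspace_dimension_le:
  assumes V: "symbol_subspace p a b V"
    and bound: "\<And>Us. A.independent sK Us \<Longrightarrow> set Us \<subseteq> V \<Longrightarrow> length Us \<le> m"
  shows "\<exists>n\<le>m. symbol_dim p a b n V"
proof -
  have sub: "additive_subgroup V sA" and smult: "\<And>c v. c \<in> sK \<Longrightarrow> v \<in> V \<Longrightarrow> c \<otimes>\<^bsub>sA\<^esub> v \<in> V"
    using V by (auto simp: symbol_subspace_def)
  have carrier: "V \<subseteq> carrier sA" by (rule additive_subgroup.a_subset[OF sub])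
  let ?P = "\<lambda>n. \<exists>Us. A.independent sK Us \<and> set Us \<subseteq> V \<and> length Us = n"
  have "?P 0" by (intro exI[of _ "[]"]) auto
  then obtain n where n: "?P n" "\<And>k. ?P k \<Longrightarrow> k \<le> n"
    using Nat.ex_has_greatest_nat[of ?P 0 m] bound by blast
  then obtain Us where Us: "A.independent sK Us" "set Us \<subseteq> V" "length Us = n" by blast
  have "A.Span sK Us = V"
  proof
    show "A.Span sK Us \<subseteq> V"
    proof (rule A.Span_min[OF subfield_scalars])
      show "set Us \<subseteq> carrier sA" using Us carrier by blast
      show "subgroup V (add_monoid sA)" by (rule additive_subgroup.a_subgroup[OF sub])
      show "sK <#>\<^bsub>sA\<^esub> set Us \<subseteq> V" using smult Us(2) by (auto simp: set_mult_def)
    qed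
    show "V \<subseteq> A.Span sK Us"
    proof
      fix v assume v: "v \<in> V"
      show "v \<in> A.Span sK Us"
      proof (rule ccontr)
        assume "v \<notin> A.Span sK Us"
        then have "A.independent sK (v # Us)"
          using v carrier Us(1) by (intro A.li_Cons) auto
        then have "?P (Suc n)" using v Us by (intro exI[of _ "v # Us"]) simp
        then show False using n(2) by fastforce
      qed
    qed
  qed
  then have "symbol_dim p a b n V"
    using A.dimensionI[OF subfield_scalars Us(1)] Us(3) by (simp add: symbol_dim_def)
  moreover have "n \<le> m" using bound Us by blast
  ultimately show ?thesis by blast
qed

text \<open>
  The witness is \<open>F + F[x] y\<close>, spanned by \<open>1\<close> and the \<open>x\<^sup>i y\<close> with \<open>i < p\<close>.
\<close>

lemma p_central_subspace_exists:
  "\<exists>V. p_central_subspace p a b V \<and> symbol_dim p a b (p + 1) V"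
proof -
  define us where "us = (1 :: 'f free_alg) # map (\<lambda>i. gx ^ i * gy) [0..<p]"
  let ?Us = "map cl us"
  let ?V = "A.Span sK ?Us"
  have len: "length us = p + 1" by (simp add: us_def)
  have Us: "set ?Us \<subseteq> carrier sA" by (auto simp: cl_closed)
  have sum: "(\<Sum>k<length us. free_scalar (cs ! k) * us ! k) =
      free_scalar (cs ! 0) + (\<Sum>i<p. free_scalar (cs ! Suc i) * (gx ^ i * gy))" for cs
    unfolding len Suc_eq_plus1[symmetric] by (subst sum.lessThan_Suc_shift) (simp add: us_def)
  have ind: "A.independent sK ?Us"
  proof (rule ccontr)
    assume "\<not> ?thesis"
    then obtain Ks where Ks: "length Ks = length ?Us" "A.combine Ks ?Us = \<zero>\<^bsub>sA\<^esub>" "set Ks \<subseteq> sK"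
      "set Ks \<noteq> {\<zero>\<^bsub>sA\<^esub>}"
      using A.dependent_imp_non_trivial_combine[OF subfield_scalars Us] by blast
    obtain cs where cs: "Ks = map (\<lambda>c. cl (free_scalar c)) cs"
      using Ks(3) by (rule scalar_listE)
    have lcs: "length cs = length us" using Ks(1) cs by simp
    have "free_scalar (cs ! 0) + (\<Sum>i<p. free_scalar (cs ! Suc i) * (gx ^ i * gy)) \<in> sI"
      using Ks(2) combine_cl[OF lcs] by (simp add: cs sum cl_eq_0)
    from basis_independent[OF this] have "cs ! k = 0" if "k < p + 1" for k
      using that by (cases k) auto
    then have "\<forall>c\<in>set cs. c = 0" using lcs len by (auto simp: in_set_conv_nth)
    then have "set Ks \<subseteq> {\<zero>\<^bsub>sA\<^esub>}" by (auto simp: cs cl_0 free_scalar_simps)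
    moreover have "set Ks \<noteq> {}" using lcs len by (auto simp: cs)
    ultimately show False using Ks(4) by (metis subset_singletonD)
  qed
  have "symbol_subspace p a b ?V"
    unfolding symbol_subspace_def
    using A.Span_is_add_subgroup[OF subfield_scalars Us] A.Span_smult_closed[OF subfield_scalars Us]
    by (auto intro: additive_subgroup.intro)
  moreover have "p_central p a b z" if z: "z \<in> ?V" for z
  proof -
    obtain Ks where Ks: "set Ks \<subseteq> sK" "length Ks = length ?Us" "z = A.combine Ks ?Us"
      using z A.Span_mem_iff_length_version[OF subfield_scalars Us] by blast
    obtain cs where cs: "Ks = map (\<lambda>c. cl (free_scalar c)) cs"
      using Ks(1) by (rule scalar_listE)
    have lcs: "length cs = length us" using Ks(2) cs by simp
    define g where "g = (\<Sum>i<p. monom (cs ! Suc i) i)"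
    have "ev g = (\<Sum>i<p. free_scalar (cs ! Suc i) * gx ^ i)"
    proof -
      have "degree g \<le> p"
        unfolding g_def by (rule degree_sum_le) (auto intro: order_trans[OF degree_monom_le])
      then have "ev g = (\<Sum>i\<le>p. free_scalar (coeff g i) * gx ^ i)" by (rule ev_superset)
      also have "\<dots> = (\<Sum>i<p. free_scalar (coeff g i) * gx ^ i)"
        by (rule sum.mono_neutral_right) (auto simp: g_def coeff_sum free_scalar_simps)
      also have "\<dots> = (\<Sum>i<p. free_scalar (cs ! Suc i) * gx ^ i)"
        by (rule sum.cong) (auto simp: g_def coeff_sum)
      finally show ?thesis .
    qed
    then have evg: "ev g * gy = (\<Sum>i<p. free_scalar (cs ! Suc i) * (gx ^ i * gy))"
      by (simp add: sum_distrib_right mult.assoc)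
    have zcl: "z = cl (ev g * gy + free_scalar (cs ! 0))"
      unfolding Ks(3) cs combine_cl[OF lcs] sum evg by (simp add: add.commute)
    obtain c where c: "(ev g * gy) ^ p - free_scalar c \<in> sI"
      using power_p_ev_Y by blast
    have "(ev g * gy + free_scalar (cs ! 0)) ^ p - free_scalar (c + (cs ! 0) ^ p) \<in> sI"
      using c by (simp add: power_p_add_scalar free_scalar_simps)
    then have "z [^]\<^bsub>sA\<^esub> p = cl (free_scalar (c + (cs ! 0) ^ p))"
      by (simp add: zcl cl_pow cl_eq_iff)
    then show ?thesis
      by (auto simp: p_central_def zcl cl_closed symbol_scalars_def)
  qed
  ultimately have "p_central_subspace p a b ?V"
    by (simp add: p_central_subspace_def)
  moreover have "symbol_dim p a b (p + 1) ?V"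
    using A.dimension_independent[OF ind] len by (simp add: symbol_dim_def)
  ultimately show ?thesis by blast
qed

end

context graded_setting
begin

lemma p_central_subspace_dim_le:
  assumes V: "p_central_subspace p a b V"
  shows "\<exists>n\<le>p + 1. symbol_dim p a b n V"
proof (rule subspace_dimension_le)
  show sub: "symbol_subspace p a b V" using V by (simp add: p_central_subspace_def)
  let ?W = "{u. cl u \<in> V}"
  have "additive_subgroup V sA" using sub by (simp add: symbol_subspace_def)
  then have add: "\<zero>\<^bsub>sA\<^esub> \<in> V" "\<And>u v. u \<in> V \<Longrightarrow> v \<in> V \<Longrightarrow> u \<oplus>\<^bsub>sA\<^esub> v \<in> V"
    by (auto intro: additive_subgroup.zero_closed additive_subgroup.a_closed)
  have smult: "cl (free_scalar c) \<otimes>\<^bsub>sA\<^esub> v \<in> V" if "v \<in> V" for c v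
    using sub that by (auto simp: symbol_subspace_def symbol_scalars_def)
  have pow: "\<exists>c. u ^ p - free_scalar c \<in> sI" if "cl u \<in> V" for u
  proof -
    have "p_central p a b (cl u)" using V that by (simp add: p_central_subspace_def)
    then show ?thesis by (auto simp: p_central_def cl_pow symbol_scalars_def cl_eq_iff)
  qed
  have W: "p_central_lift ?W"
    unfolding p_central_lift_def
  proof (intro conjI ballI allI)
    show "0 \<in> ?W" using add(1) by (simp add: cl_0)
  next
    fix u v assume "u \<in> ?W" "v \<in> ?W"
    then show "u + v \<in> ?W" using add(2)[of "cl u" "cl v"] by (simp add: cl_add)
  next
    fix c u assume "u \<in> ?W"
    then show "free_scalar c * u \<in> ?W" using smult[of "cl u" c] by (simp add: cl_mult)
  next
    fix u assume "u \<in> ?W"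
    then show "\<exists>c. u ^ p - free_scalar c \<in> sI" using pow by simp
  qed
  fix Us assume ind: "A.independent sK Us" and Us: "set Us \<subseteq> V"
  show "length Us \<le> p + 1"
  proof (rule ccontr)
    assume "\<not> ?thesis"
    then have card: "card {..<length Us} > p + 1" by simp
    have "set Us \<subseteq> range cl" using A.independent_in_carrier[OF ind] carrier_cl by simp
    then have "\<exists>us. Us = map cl us" unfolding ex_map_conv by blast
    then obtain us where us: "Us = map cl us" by blast
    have "\<exists>g. (\<exists>k\<in>{..<length Us}. g k \<noteq> 0) \<and> (\<Sum>k<length Us. free_scalar (g k) * us ! k) \<in> sI"
      by (rule p_central_lift_dependent[OF W finite_lessThan card]) (use Us in \<open>auto simp: us\<close>)
    then obtain g where
      g: "\<exists>k<length Us. g k \<noteq> 0" "(\<Sum>k<length Us. free_scalar (g k) * us ! k) \<in> sI" by auto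
    let ?cs = "map g [0..<length Us]"
    let ?Ks = "map (\<lambda>c. cl (free_scalar c)) ?cs"
    have "A.combine ?Ks Us = cl (\<Sum>k<length us. free_scalar (?cs ! k) * us ! k)"
      unfolding us by (rule combine_cl) simp
    also have "\<dots> = \<zero>\<^bsub>sA\<^esub>"
      using g(2) by (simp add: cl_eq_0 us)
    finally have "set (take (length Us) ?Ks) \<subseteq> {\<zero>\<^bsub>sA\<^esub>}"
      by (intro A.independent_imp_trivial_combine[OF subfield_scalars ind]) (auto simp: symbol_scalars_def)
    then have "cl (free_scalar (g k)) = \<zero>\<^bsub>sA\<^esub>" if "k < length Us" for k
      using that by (simp add: image_subset_iff)
    then show False using g(1) by (auto simp: cl_eq_0 free_scalar_in_ideal)
  qed
qed

lemma max_p_central_dim: "max_p_central_dim p a b (p + 1)"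
  unfolding max_p_central_dim_def
  using p_central_subspace_exists p_central_subspace_dim_le by blast

end

section \<open>Degree functions of the two base fields\<close>

lemma degree_function_inverse:
  fixes d :: "'a::field \<Rightarrow> int poly"
  assumes "degree_function d" "x \<noteq> 0"
  shows "d (inverse x) = - d x"
proof -
  have "d (x * inverse x) = d x + d (inverse x)"
    using assms unfolding degree_function_def by (metis inverse_nonzero_iff_nonzero)
  then show ?thesis
    using assms degree_function_1[OF assms(1)] by (simp add: eq_neg_iff_add_eq_0 add.commute)
qed

lemma int_poly_lex: "[:x, y:] \<le> [:x', y' :: int:] \<longleftrightarrow> y < y' \<or> (y = y' \<and> x \<le> x')"
  by (auto simp: less_eq_poly_def pos_poly_pCons)

text \<open>
  The series variables are the inverses of \<open>\<alpha>\<close> and \<open>\<beta>\<close>, so the degree is the negated pair of the orders: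
  the order in \<open>\<beta>\<^sup>-\<^sup>1\<close>, which dominates, and the order in \<open>\<alpha>\<^sup>-\<^sup>1\<close> of the lowest coefficient.
\<close>

definition laurent_degree :: "'k::field fls fls \<Rightarrow> int poly"
  where "laurent_degree f = [:- fls_subdegree (fls_nth f (fls_subdegree f)), - fls_subdegree f:]"

lemma laurent_degree_function: "degree_function (laurent_degree :: 'k::field fls fls \<Rightarrow> int poly)"
  unfolding degree_function_def
proof (intro conjI allI impI)
  fix f g :: "'k fls fls"
  assume f: "f \<noteq> 0" and g: "g \<noteq> 0"
  then show "laurent_degree (f * g) = laurent_degree f + laurent_degree g"
    by (simp add: laurent_degree_def)
  assume fg: "f + g \<noteq> 0"
  have lt: "laurent_degree (f + g) \<le> laurent_degree f"
    if "fls_subdegree f < fls_subdegree g" "f \<noteq> 0" for f g :: "'k fls fls"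
    using that fls_subdegree_add_eq1[OF that(2,1)] by (simp add: laurent_degree_def)
  consider "fls_subdegree f < fls_subdegree g" | "fls_subdegree g < fls_subdegree f"
    | "fls_subdegree f = fls_subdegree g" by linarith
  then show "laurent_degree (f + g) \<le> max (laurent_degree f) (laurent_degree g)"
  proof cases
    case 1
    then show ?thesis using lt[of f g] f by (simp add: le_max_iff_disj)
  next
    case 2
    then show ?thesis using lt[of g f] g by (simp add: le_max_iff_disj add.commute)
  next
    case 3
    let ?s = "fls_subdegree f"
    have ge: "?s \<le> fls_subdegree (f + g)"
      using fls_plus_subdegree[OF fg] 3 by simp
    show ?thesis
    proof (cases "fls_subdegree (f + g) = ?s")
      case True
      then have nz: "fls_nth f ?s + fls_nth g ?s \<noteq> 0"
        using nth_fls_subdegree_nonzero[OF fg] by simp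
      then have "min (fls_subdegree (fls_nth f ?s)) (fls_subdegree (fls_nth g ?s)) \<le> fls_subdegree (fls_nth f ?s + fls_nth g ?s)"
        by (rule fls_plus_subdegree)
      then show ?thesis
        using 3 True by (auto simp: laurent_degree_def le_max_iff_disj int_poly_lex)
    next
      case False
      then show ?thesis
        using 3 ge by (auto simp: laurent_degree_def le_max_iff_disj int_poly_lex)
    qed
  qed
qed

lemma laurent_degree_generators:
  "laurent_degree (laurent_alpha :: 'k::field fls fls) = 1"
  "laurent_degree (laurent_beta :: 'k::field fls fls) = [:0, 1:]"
  "laurent_alpha \<noteq> (0 :: 'k::field fls fls)" "laurent_beta \<noteq> (0 :: 'k::field fls fls)"
proof -
  have "fls_const fls_X \<noteq> (0 :: 'k fls fls)" by simp
  then show "laurent_degree (laurent_alpha :: 'k fls fls) = 1"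
    using degree_function_inverse[OF laurent_degree_function, of "fls_const fls_X :: 'k fls fls"]
    by (simp add: laurent_alpha_def laurent_degree_def one_pCons)
  show "laurent_degree (laurent_beta :: 'k fls fls) = [:0, 1:]"
    using degree_function_inverse[OF laurent_degree_function, of "fls_X :: 'k fls fls"]
    by (simp add: laurent_beta_def laurent_degree_def)
qed (simp_all add: laurent_alpha_def laurent_beta_def)

text \<open>
  The degree in \<open>\<beta>\<close>, which dominates, and the degree in \<open>\<alpha>\<close> of the leading coefficient.
\<close>

definition bipoly_degree :: "'k::field poly poly \<Rightarrow> int poly"
  where "bipoly_degree f = [:int (degree (lead_coeff f)), int (degree f):]"

lemma bipoly_degree_function: "degree_function (bipoly_degree :: 'k::field poly poly \<Rightarrow> int poly)"
  unfolding degree_function_def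
proof (intro conjI allI impI)
  fix f g :: "'k poly poly"
  assume f: "f \<noteq> 0" and g: "g \<noteq> 0"
  then show "bipoly_degree (f * g) = bipoly_degree f + bipoly_degree g"
    by (simp add: bipoly_degree_def coeff_mult_degree_sum degree_mult_eq)
  assume fg: "f + g \<noteq> 0"
  have lt: "bipoly_degree (f + g) = bipoly_degree f" if "degree g < degree f" for f g :: "'k poly poly"
    using that by (simp add: bipoly_degree_def degree_add_eq_left coeff_eq_0)
  consider "degree g < degree f" | "degree f < degree g" | "degree f = degree g" by linarith
  then show "bipoly_degree (f + g) \<le> max (bipoly_degree f) (bipoly_degree g)"
  proof cases
    case 1
    then show ?thesis using lt[of g f] by (simp add: le_max_iff_disj)
  next
    case 2
    then show ?thesis using lt[of f g] by (simp add: le_max_iff_disj add.commute)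
  next
    case 3
    have le: "degree (f + g) \<le> degree f"
      using degree_add_le_max[of f g] 3 by simp
    show ?thesis
    proof (cases "degree (f + g) = degree f")
      case True
      then have "degree (lead_coeff (f + g)) \<le> max (degree (lead_coeff f)) (degree (lead_coeff g))"
        using degree_add_le_max[of "lead_coeff f" "lead_coeff g"] 3 by simp
      then show ?thesis
        using 3 True by (auto simp: bipoly_degree_def le_max_iff_disj int_poly_lex)
    next
      case False
      then show ?thesis
        using 3 le by (auto simp: bipoly_degree_def le_max_iff_disj int_poly_lex)
    qed
  qed
qed

text \<open>
  The extension of a degree function to the field of fractions. By \<open>fract_degree_Fract\<close> it does not
  depend on the representation chosen.
\<close>

definition fract_degree :: "('a::idom \<Rightarrow> int poly) \<Rightarrow> 'a fract \<Rightarrow> int poly"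
  where "fract_degree d q = (SOME z. \<exists>x y. x \<noteq> 0 \<and> y \<noteq> 0 \<and> q = Fract x y \<and> z = d x - d y)"

lemma fract_degree_Fract:
  assumes d: "degree_function d" and xy: "x \<noteq> 0" "y \<noteq> 0"
  shows "fract_degree d (Fract x y) = d x - d y"
proof -
  have "\<exists>x' y'. x' \<noteq> 0 \<and> y' \<noteq> 0 \<and> Fract x y = Fract x' y' \<and> fract_degree d (Fract x y) = d x' - d y'"
    unfolding fract_degree_def by (rule someI_ex) (use xy in blast)
  then obtain x' y' where *: "x' \<noteq> 0" "y' \<noteq> 0" "Fract x y = Fract x' y'"
    "fract_degree d (Fract x y) = d x' - d y'" by blast
  have "x * y' = x' * y" using * xy by (simp add: eq_fract)
  then have "d x + d y' = d x' + d y"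
    using d * xy unfolding degree_function_def by metis
  then show ?thesis using *(4) by (simp add: algebra_simps)
qed

lemma fract_degree_function:
  assumes d: "degree_function d"
  shows "degree_function (fract_degree d)"
  unfolding degree_function_def
proof (intro conjI allI impI)
  have mult: "d (x * y) = d x + d y" if "x \<noteq> 0" "y \<noteq> 0" for x y
    using d that by (simp add: degree_function_def)
  fix q r :: "'a fract"
  assume q: "q \<noteq> 0" and r: "r \<noteq> 0"
  obtain x y where xy: "q = Fract x y" "y \<noteq> 0" by (cases q)
  obtain z w where zw: "r = Fract z w" "w \<noteq> 0" by (cases r)
  have x: "x \<noteq> 0" using q xy by (auto simp: fract_collapse)
  have z: "z \<noteq> 0" using r zw by (auto simp: fract_collapse)
  show "fract_degree d (q * r) = fract_degree d q + fract_degree d r"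
    using x z xy zw by (simp add: fract_degree_Fract[OF d] mult)
  assume "q + r \<noteq> 0"
  then have s: "x * w + z * y \<noteq> 0"
    using xy zw by (auto simp: fract_collapse)
  then have "d (x * w + z * y) \<le> max (d (x * w)) (d (z * y))"
    using d x z xy zw unfolding degree_function_def by (metis mult_eq_0_iff)
  then have "d (x * w + z * y) - d (y * w) \<le> max (d x - d y) (d z - d w)"
    using x z xy zw by (auto simp: mult le_max_iff_disj algebra_simps)
  then show "fract_degree d (q + r) \<le> max (fract_degree d q) (fract_degree d r)"
    using s x z xy zw by (simp add: fract_degree_Fract[OF d])
qed

abbreviation "ratfun_degree \<equiv> fract_degree bipoly_degree"

lemma ratfun_degree_generators:
  "ratfun_degree (ratfun_alpha :: 'k::field poly poly fract) = 1"
  "ratfun_degree (ratfun_beta :: 'k::field poly poly fract) = [:0, 1:]"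
  "ratfun_alpha \<noteq> (0 :: 'k::field poly poly fract)" "ratfun_beta \<noteq> (0 :: 'k::field poly poly fract)"
  by (simp_all add: ratfun_alpha_def ratfun_beta_def fract_degree_Fract[OF bipoly_degree_function]
      bipoly_degree_def one_pCons Zero_fract_def eq_fract)

lemma CHAR_fract: "CHAR('a::idom fract) = CHAR('a)"
proof (rule CHAR_eqI)
  have of_nat: "of_nat n = Fract (of_nat n) (1::'a)" for n
    by (induction n) (simp_all add: Zero_fract_def One_fract_def)
  show "of_nat CHAR('a) = (0 :: 'a fract)"
    by (simp add: of_nat Zero_fract_def)
  show "CHAR('a) dvd n" if "of_nat n = (0 :: 'a fract)" for n
    using that by (simp add: of_nat Zero_fract_def eq_fract of_nat_eq_0_iff_char_dvd)
qed

lemma graded_settingI: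
  fixes a b :: "'f::field"
  assumes "prime p" "CHAR('f) = p" "degree_function d" "a \<noteq> 0" "b \<noteq> 0" "d a = 1" "d b = [:0, 1:]"
  shows "graded_setting p a b d"
  using assms by unfold_locales

section \<open>The maximal dimension\<close>

theorem theorem3p1:
  fixes p :: nat
  assumes "prime p" and "CHAR('k::field) = p"
  shows "max_p_central_dim p (ratfun_alpha :: 'k poly poly fract) ratfun_beta (p + 1) \<and>
         max_p_central_dim p (laurent_alpha :: 'k fls fls) laurent_beta (p + 1)"
proof
  have "graded_setting p (ratfun_alpha :: 'k poly poly fract) ratfun_beta ratfun_degree"
    using assms by (intro graded_settingI ratfun_degree_generators fract_degree_function bipoly_degree_function)
      (simp_all add: CHAR_fract)
  then show "max_p_central_dim p (ratfun_alpha :: 'k poly poly fract) ratfun_beta (p + 1)"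
    by (rule graded_setting.max_p_central_dim)
  have "graded_setting p (laurent_alpha :: 'k fls fls) laurent_beta laurent_degree"
    using assms by (intro graded_settingI laurent_degree_generators laurent_degree_function) simp_all
  then show "max_p_central_dim p (laurent_alpha :: 'k fls fls) laurent_beta (p + 1)"
    by (rule graded_setting.max_p_central_dim)
qed

end
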